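(* Let $\Sigma\subset\mathbb{Z}^N$ be simply connected and let $s:\Sigma\to\mathcal{Q}\setminus\mathbb{P}(\mathcal{L}\cap\mathfrak{q}^\perp)$ be a (regular) $Q$-net with circular stereoprojection $x:\Sigma\to\mathbb{R}^{p,q}$. Then $s$ is isothermic if and only if $x$ has a Koenigs dual $\check{x}:\Sigma\to\mathbb{R}^{p,q}$, that is, a map $\check x$ which is edge-parallel to $x$ with $\mathrm{d}x\curlywedge\mathrm{d}\check{x}=0$. In this case, $\check{x}$ is also the stereoprojection of an isothermic net. In view of this, $x:\Sigma\to\mathbb{R}^{p,q}$ is called isothermic if it is circular and has a Koenigs dual, and $\check x$ is called a Christoffel dual of $x$. The Christoffel dual $\check x$ is determined by $x$ up to translation and a constant scaling (and then the closed $1$-form $\eta$ of $s$ is scaled in the same way).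
   Context: Domain: an edge $ij$ of $\Sigma\subset\mathbb{Z}^N$ is a pair of points of $\Sigma$ differing by a standard unit vector; a quadrilateral is an elementary square with all four vertices $i,j,k,\ell$ (in cyclic order) in $\Sigma$. $\Sigma$ is simply connected if any two points are joined by an edge-path in $\Sigma$ and any two edge-paths in $\Sigma$ with the same end-points are related by finitely many moves: (a) replace $i$ by $(iji)$ or conversely, $ij$ an edge; (b) replace $(k\ell i)$ by $(kji)$ on a quadrilateral. A vector-valued $1$-form $\alpha$ assigns $\alpha_{ji}=-\alpha_{ij}$ to each oriented edge from $i$ to $j$; it is closed if $\alpha_{i\ell}+\alpha_{\ell k}+\alpha_{kj}+\alpha_{ji}=0$ on every quadrilateral. $\mathrm{d}x_{ji}=x_j-x_i$. For vector-valued $1$-forms, $(\alpha\curlywedge\beta)_{\ell kji}=\tfrac14\bigl((\alpha_{ji}+\alpha_{k\ell})\wedge(\beta_{\ell i}+\beta_{kj})-(\alpha_{\ell i}+\alpha_{kj})\wedge(\beta_{ji}+\beta_{k\ell})\bigr)$. $\mathbb{R}^{p+1,q+1}$ has a non-degenerate symmetric bilinear form $(\cdot,\cdot)$ of signature $(p+1,q+1)$; $\mathcal{L}$ is its light cone and $\mathcal{Q}=\mathbb{P}(\mathcal{L})$. $\Lambda^2\mathbb{R}^{p+1,q+1}$ acts on $\mathbb{R}^{p+1,q+1}$ by $(a\wedge b)(z)=(a,z)b-(b,z)a$. A map $s:\Sigma\to\mathcal{Q}$ is viewed as a null line subbundle. Regular (standing assumption on nets in $\mathcal{Q}$, including the inverse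 stereoprojection of $\check x$): on each quadrilateral $s_i,s_j,s_k,s_\ell$ are pairwise distinct, $\dim(s_i+s_j+s_k+s_\ell)\ge3$, and the diagonals are non-isotropic ($s_i\not\perp s_k$, $s_j\not\perp s_\ell$). $s$ is a $Q$-net if its quadrilaterals are planar: $\dim(s_i+s_j+s_k+s_\ell)\leq3$. $s$ is isothermic if there is a closed, never-zero $\Lambda^2\mathbb{R}^{p+1,q+1}$-valued $1$-form $\eta$ with $\eta_{ji}\in s_j\wedge s_i$ on each edge. Stereoprojection: fix $\mathfrak{o},\mathfrak{q}\in\mathcal{L}$ with $(\mathfrak{o},\mathfrak{q})=-1$, set $\mathbb{R}^{p,q}=\langle\mathfrak{o},\mathfrak{q}\rangle^\perp$ and let $\pi:\mathbb{R}^{p+1,q+1}\to\mathbb{R}^{p,q}$ be orthogonal projection. Inverse stereoprojection is $x\mapsto\langle\mathfrak{o}+x+\tfrac12(x,x)\mathfrak{q}\rangle$, a bijection $\mathbb{R}^{p,q}\to\mathcal{Q}\setminus\mathbb{P}(\mathcal{L}\cap\mathfrak{q}^\perp)$. A map $x:\Sigma\to\mathbb{R}^{p,q}$ is circular if on each quadrilateral its four vertices are not (affinely) collinear and its inverse stereoprojection $s$ has $\dim(s_i+s_j+s_k+s_\ell)=3$. Edge-parallel: $\mathrm{d}\check x_{ij}$ is a non-zero real multiple of $\mathrm{d}x_{ij}$ on each edge. The $1$-form $\eta$ of $s$ and the Christoffel dual $\check x$ are related by $\mathrm{d}\check x=\pi(\eta\mathfrak{q})$.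
   Formalization: Uniqueness up to one constant scaling is proved when any two edges are linked by a chain of quadrilaterals (otherwise one scaling per linked class; it fails for Σ={0,1,2}); edge-parallel also requires dx to be non-zero on every edge, without which the equivalence fails for Σ={0,1}, s constant. *)

theory Defs
  imports "HOL-Analysis.Analysis"
begin

type_synonym 'm lattice = "int ^ 'm"

definition edge :: "('m::finite) lattice set \<Rightarrow> 'm lattice \<Rightarrow> 'm lattice \<Rightarrow> bool" where
  "edge \<Sigma> i j \<longleftrightarrow> i \<in> \<Sigma> \<and> j \<in> \<Sigma> \<and> (\<exists>a. j - i = axis a 1 \<or> i - j = axis a 1)"

text \<open>The two signs make every cyclic labelling of an elementary square available, in both
  orientations and from every starting vertex.\<close>

definition quadrilateral ::
  "('m::finite) lattice set \<Rightarrow> 'm lattice \<Rightarrow> 'm lattice \<Rightarrow> 'm lattice \<Rightarrow> 'm lattice \<Rightarrow> bool" where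
  "quadrilateral \<Sigma> i j k l \<longleftrightarrow> {i, j, k, l} \<subseteq> \<Sigma> \<and>
     (\<exists>a b \<sigma> \<tau>. a \<noteq> b \<and> \<sigma> \<in> {1, -1} \<and> \<tau> \<in> {1, -1} \<and>
        j = i + axis a \<sigma> \<and> k = i + axis a \<sigma> + axis b \<tau> \<and> l = i + axis b \<tau>)"

definition edge_path :: "('m::finite) lattice set \<Rightarrow> 'm lattice list \<Rightarrow> bool" where
  "edge_path \<Sigma> ps \<longleftrightarrow> ps \<noteq> [] \<and> set ps \<subseteq> \<Sigma> \<and> successively (edge \<Sigma>) ps"

inductive path_move :: "('m::finite) lattice set \<Rightarrow> 'm lattice list \<Rightarrow> 'm lattice list \<Rightarrow> bool"
  for \<Sigma> where
  spike: "edge \<Sigma> i j \<Longrightarrow> path_move \<Sigma> (ps @ [i] @ qs) (ps @ [i, j, i] @ qs)"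
| flip: "quadrilateral \<Sigma> i j k l \<Longrightarrow> path_move \<Sigma> (ps @ [k, l, i] @ qs) (ps @ [k, j, i] @ qs)"

definition simply_connected_domain :: "('m::finite) lattice set \<Rightarrow> bool" where
  "simply_connected_domain \<Sigma> \<longleftrightarrow>
     (\<forall>i\<in>\<Sigma>. \<forall>j\<in>\<Sigma>. \<exists>ps. edge_path \<Sigma> ps \<and> hd ps = i \<and> last ps = j) \<and>
     (\<forall>ps qs. edge_path \<Sigma> ps \<and> edge_path \<Sigma> qs \<and> hd ps = hd qs \<and> last ps = last qs \<longrightarrow>
        equivclp (path_move \<Sigma>) ps qs)"

text \<open>Unoriented edges are two-element sets. They are linked if a chain of edges joins them in
  which any two successive edges belong to a common quadrilateral. A closed 1-form can be rescaled
  independently on each class of linked edges, so duality can only be unique up to one scaling per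
  class.\<close>

definition share_quadrilateral ::
  "('m::finite) lattice set \<Rightarrow> 'm lattice set \<Rightarrow> 'm lattice set \<Rightarrow> bool" where
  "share_quadrilateral \<Sigma> e f \<longleftrightarrow>
     (\<exists>i j k l. quadrilateral \<Sigma> i j k l \<and> {e, f} \<subseteq> {{i, j}, {j, k}, {k, l}, {l, i}})"

definition linked :: "('m::finite) lattice set \<Rightarrow> 'm lattice set \<Rightarrow> 'm lattice set \<Rightarrow> bool" where
  "linked \<Sigma> = (share_quadrilateral \<Sigma>)\<^sup>*\<^sup>*"

definition quad_connected :: "('m::finite) lattice set \<Rightarrow> bool" where
  "quad_connected \<Sigma> \<longleftrightarrow>
     (\<forall>i j i' j'. edge \<Sigma> i j \<and> edge \<Sigma> i' j' \<longrightarrow> linked \<Sigma> {i, j} {i', j'})"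

definition nondegenerate_form :: "(real ^ 'n \<Rightarrow> real ^ 'n \<Rightarrow> real) \<Rightarrow> bool" where
  "nondegenerate_form B \<longleftrightarrow> (\<forall>v. (\<forall>w. B v w = 0) \<longrightarrow> v = 0)"

definition has_signature :: "(real ^ 'n \<Rightarrow> real ^ 'n \<Rightarrow> real) \<Rightarrow> nat \<Rightarrow> nat \<Rightarrow> bool" where
  "has_signature B m n \<longleftrightarrow>
     (\<exists>P M. P \<inter> M = {} \<and> independent (P \<union> M) \<and> span (P \<union> M) = UNIV \<and> card P = m \<and> card M = n \<and>
        (\<forall>u\<in>P \<union> M. \<forall>v\<in>P \<union> M. u \<noteq> v \<longrightarrow> B u v = 0) \<and>
        (\<forall>u\<in>P. B u u = 1) \<and> (\<forall>u\<in>M. B u u = -1))"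

definition symmetric_form :: "(real ^ 'n \<Rightarrow> real ^ 'n \<Rightarrow> real) \<Rightarrow> nat \<Rightarrow> nat \<Rightarrow> bool" where
  "symmetric_form B m n \<longleftrightarrow>
     bilinear B \<and> (\<forall>v w. B v w = B w v) \<and> nondegenerate_form B \<and> has_signature B m n"

text \<open>The exterior square of \<open>real ^ 'n\<close> is the space of skew-symmetric matrices, that is,
  skew-symmetric 2-tensors.\<close>

definition wedge :: "real ^ 'n \<Rightarrow> real ^ 'n \<Rightarrow> real ^ 'n ^ 'n" where
  "wedge a b = (\<chi> r c. a $ r * b $ c - a $ c * b $ r)"

definition wedge_space :: "(real ^ 'n) set \<Rightarrow> (real ^ 'n) set \<Rightarrow> (real ^ 'n ^ 'n) set" where
  "wedge_space U W = span {wedge a b | a b. a \<in> U \<and> b \<in> W}"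

text \<open>Contraction of the first tensor factor with the form: the linear extension of the action on
  decomposables, see \<open>act_wedge\<close>.\<close>

definition act :: "(real ^ 'n \<Rightarrow> real ^ 'n \<Rightarrow> real) \<Rightarrow> real ^ 'n ^ 'n \<Rightarrow> real ^ 'n \<Rightarrow> real ^ 'n" where
  "act B \<omega> z = (\<chi> c. \<Sum>r\<in>UNIV. \<omega> $ r $ c * B (axis r 1) z)"

lemma act_wedge:
  assumes "bilinear B"
  shows "act B (wedge a b) z = B a z *\<^sub>R b - B b z *\<^sub>R a"
proof -
  have lin: "linear (\<lambda>v. B v z)"
    using assms by (simp add: bilinear_def)
  have expand: "B v z = (\<Sum>r\<in>UNIV. v $ r * B (axis r 1) z)" for v
  proof -
    have "B v z = B (\<Sum>r\<in>UNIV. (v $ r) *\<^sub>R axis r 1) z"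
      using basis_expansion[of v] by (simp add: scalar_mult_eq_scaleR)
    also have "\<dots> = (\<Sum>r\<in>UNIV. v $ r * B (axis r 1) z)"
      by (simp add: linear_sum[OF lin] linear_scale[OF lin])
    finally show ?thesis .
  qed
  show ?thesis
    unfolding vec_eq_iff act_def wedge_def expand[of a] expand[of b]
    by (simp add: algebra_simps sum_subtractf sum_distrib_left)
qed

text \<open>\<open>\<alpha> j i\<close> is the value on the oriented edge from \<open>i\<close> to \<open>j\<close>; only the values on edges of the
  domain matter.\<close>

definition one_form ::
  "('m::finite) lattice set \<Rightarrow> ('m lattice \<Rightarrow> 'm lattice \<Rightarrow> 'v::real_vector) \<Rightarrow> bool" where
  "one_form \<Sigma> \<alpha> \<longleftrightarrow> (\<forall>i j. edge \<Sigma> i j \<longrightarrow> \<alpha> j i = - \<alpha> i j)"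

definition closed_form ::
  "('m::finite) lattice set \<Rightarrow> ('m lattice \<Rightarrow> 'm lattice \<Rightarrow> 'v::real_vector) \<Rightarrow> bool" where
  "closed_form \<Sigma> \<alpha> \<longleftrightarrow>
     (\<forall>i j k l. quadrilateral \<Sigma> i j k l \<longrightarrow> \<alpha> i l + \<alpha> l k + \<alpha> k j + \<alpha> j i = 0)"

definition diff1 :: "('m lattice \<Rightarrow> 'v::real_vector) \<Rightarrow> 'm lattice \<Rightarrow> 'm lattice \<Rightarrow> 'v" where
  "diff1 x j i = x j - x i"

definition curly_wedge ::
  "('m lattice \<Rightarrow> 'm lattice \<Rightarrow> real ^ 'n) \<Rightarrow> ('m lattice \<Rightarrow> 'm lattice \<Rightarrow> real ^ 'n) \<Rightarrow>
   'm lattice \<Rightarrow> 'm lattice \<Rightarrow> 'm lattice \<Rightarrow> 'm lattice \<Rightarrow> real ^ 'n ^ 'n" where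
  "curly_wedge \<alpha> \<beta> l k j i = (1/4) *\<^sub>R
     (wedge (\<alpha> j i + \<alpha> k l) (\<beta> l i + \<beta> k j) - wedge (\<alpha> l i + \<alpha> k j) (\<beta> j i + \<beta> k l))"

definition light_cone :: "(real ^ 'n \<Rightarrow> real ^ 'n \<Rightarrow> real) \<Rightarrow> (real ^ 'n) set" where
  "light_cone B = {v. v \<noteq> 0 \<and> B v v = 0}"

definition projectivize :: "(real ^ 'n) set \<Rightarrow> (real ^ 'n) set set" where
  "projectivize A = {span {v} | v. v \<in> A \<and> v \<noteq> 0}"

definition quadric :: "(real ^ 'n \<Rightarrow> real ^ 'n \<Rightarrow> real) \<Rightarrow> (real ^ 'n) set set" where
  "quadric B = projectivize (light_cone B)"

definition form_orthogonal ::
  "(real ^ 'n \<Rightarrow> real ^ 'n \<Rightarrow> real) \<Rightarrow> (real ^ 'n) set \<Rightarrow> (real ^ 'n) set \<Rightarrow> bool" where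
  "form_orthogonal B U W \<longleftrightarrow> (\<forall>u\<in>U. \<forall>w\<in>W. B u w = 0)"

definition perp :: "(real ^ 'n \<Rightarrow> real ^ 'n \<Rightarrow> real) \<Rightarrow> (real ^ 'n) set \<Rightarrow> (real ^ 'n) set" where
  "perp B A = {v. \<forall>a\<in>A. B v a = 0}"

text \<open>The span of the union of subspaces is their sum.\<close>

definition quad_dim ::
  "('m lattice \<Rightarrow> (real ^ 'n) set) \<Rightarrow> 'm lattice \<Rightarrow> 'm lattice \<Rightarrow> 'm lattice \<Rightarrow> 'm lattice \<Rightarrow> nat" where
  "quad_dim s i j k l = dim (span (s i \<union> s j \<union> s k \<union> s l))"

definition regular_net ::
  "(real ^ 'n \<Rightarrow> real ^ 'n \<Rightarrow> real) \<Rightarrow> ('m::finite) lattice set \<Rightarrow>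
   ('m lattice \<Rightarrow> (real ^ 'n) set) \<Rightarrow> bool" where
  "regular_net B \<Sigma> s \<longleftrightarrow> (\<forall>i j k l. quadrilateral \<Sigma> i j k l \<longrightarrow>
     distinct [s i, s j, s k, s l] \<and> quad_dim s i j k l \<ge> 3 \<and>
     \<not> form_orthogonal B (s i) (s k) \<and> \<not> form_orthogonal B (s j) (s l))"

definition Q_net :: "('m::finite) lattice set \<Rightarrow> ('m lattice \<Rightarrow> (real ^ 'n) set) \<Rightarrow> bool" where
  "Q_net \<Sigma> s \<longleftrightarrow> (\<forall>i j k l. quadrilateral \<Sigma> i j k l \<longrightarrow> quad_dim s i j k l \<le> 3)"

definition isothermic_form ::
  "('m::finite) lattice set \<Rightarrow> ('m lattice \<Rightarrow> (real ^ 'n) set) \<Rightarrow>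
   ('m lattice \<Rightarrow> 'm lattice \<Rightarrow> real ^ 'n ^ 'n) \<Rightarrow> bool" where
  "isothermic_form \<Sigma> s \<eta> \<longleftrightarrow> one_form \<Sigma> \<eta> \<and> closed_form \<Sigma> \<eta> \<and>
     (\<forall>i j. edge \<Sigma> i j \<longrightarrow> \<eta> j i \<noteq> 0 \<and> \<eta> j i \<in> wedge_space (s j) (s i))"

definition isothermic :: "('m::finite) lattice set \<Rightarrow> ('m lattice \<Rightarrow> (real ^ 'n) set) \<Rightarrow> bool" where
  "isothermic \<Sigma> s \<longleftrightarrow> (\<exists>\<eta>. isothermic_form \<Sigma> s \<eta>)"

text \<open>The affine model is the subspace orthogonal to \<open>\<oo>\<close> and \<open>\<qq>\<close> inside the ambient space.\<close>

definition affine_model ::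
  "(real ^ 'n \<Rightarrow> real ^ 'n \<Rightarrow> real) \<Rightarrow> real ^ 'n \<Rightarrow> real ^ 'n \<Rightarrow> (real ^ 'n) set" where
  "affine_model B \<oo> \<qq> = perp B (span {\<oo>, \<qq>})"

definition inv_stereo ::
  "(real ^ 'n \<Rightarrow> real ^ 'n \<Rightarrow> real) \<Rightarrow> real ^ 'n \<Rightarrow> real ^ 'n \<Rightarrow> real ^ 'n \<Rightarrow> (real ^ 'n) set" where
  "inv_stereo B \<oo> \<qq> x = span {\<oo> + x + (1/2 * B x x) *\<^sub>R \<qq>}"

definition stereoprojection ::
  "(real ^ 'n \<Rightarrow> real ^ 'n \<Rightarrow> real) \<Rightarrow> real ^ 'n \<Rightarrow> real ^ 'n \<Rightarrow> ('m::finite) lattice set \<Rightarrow>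
   ('m lattice \<Rightarrow> (real ^ 'n) set) \<Rightarrow> ('m lattice \<Rightarrow> real ^ 'n) \<Rightarrow> bool" where
  "stereoprojection B \<oo> \<qq> \<Sigma> s x \<longleftrightarrow>
     (\<forall>i\<in>\<Sigma>. x i \<in> affine_model B \<oo> \<qq> \<and> inv_stereo B \<oo> \<qq> (x i) = s i)"

text \<open>The formula is the orthogonal projection because \<open>\<oo>\<close> and \<open>\<qq>\<close> are null with
  product \<open>-1\<close>, see \<open>affine_proj_unique\<close>.\<close>

definition affine_proj ::
  "(real ^ 'n \<Rightarrow> real ^ 'n \<Rightarrow> real) \<Rightarrow> real ^ 'n \<Rightarrow> real ^ 'n \<Rightarrow> real ^ 'n \<Rightarrow> real ^ 'n" where
  "affine_proj B \<oo> \<qq> v = v + B v \<qq> *\<^sub>R \<oo> + B v \<oo> *\<^sub>R \<qq>"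

lemma affine_model_iff:
  assumes "bilinear B"
  shows "v \<in> affine_model B \<oo> \<qq> \<longleftrightarrow> B v \<oo> = 0 \<and> B v \<qq> = 0"
proof
  assume "v \<in> affine_model B \<oo> \<qq>"
  then show "B v \<oo> = 0 \<and> B v \<qq> = 0"
    unfolding affine_model_def perp_def by (auto intro: span_base)
next
  assume "B v \<oo> = 0 \<and> B v \<qq> = 0"
  then have "B v a = 0" if "a \<in> span {\<oo>, \<qq>}" for a
    using that assms
    by (auto simp: span_insert bilinear_radd bilinear_rmul bilinear_rsub algebra_simps span_singleton
        elim!: rangeE)
  then show "v \<in> affine_model B \<oo> \<qq>"
    unfolding affine_model_def perp_def by auto
qed

lemma affine_proj_unique:
  assumes B: "bilinear B" "\<And>v w. B v w = B w v"
    and oq: "B \<oo> \<oo> = 0" "B \<qq> \<qq> = 0" "B \<oo> \<qq> = -1"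
  shows "w \<in> affine_model B \<oo> \<qq> \<and> v - w \<in> span {\<oo>, \<qq>} \<longleftrightarrow> w = affine_proj B \<oo> \<qq> v"
proof -
  note bil = bilinear_ladd[OF B(1)] bilinear_lmul[OF B(1)] bilinear_lsub[OF B(1)]
  have qo: "B \<qq> \<oo> = -1"
    using B(2) oq(3) by metis
  have "affine_proj B \<oo> \<qq> v \<in> affine_model B \<oo> \<qq>"
    unfolding affine_model_iff[OF B(1)] affine_proj_def by (simp add: bil oq qo)
  moreover have "v - affine_proj B \<oo> \<qq> v \<in> span {\<oo>, \<qq>}"
  proof -
    have "v - affine_proj B \<oo> \<qq> v = (- B v \<qq>) *\<^sub>R \<oo> + (- B v \<oo>) *\<^sub>R \<qq>"
      unfolding affine_proj_def by simp
    also have "\<dots> \<in> span {\<oo>, \<qq>}"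
      by (intro span_add span_scale span_base) auto
    finally show ?thesis .
  qed
  moreover have "w = affine_proj B \<oo> \<qq> v"
    if w: "w \<in> affine_model B \<oo> \<qq>" and d: "v - w \<in> span {\<oo>, \<qq>}"
  proof -
    from d obtain a b where "v - w - a *\<^sub>R \<oo> = b *\<^sub>R \<qq>"
      by (auto simp: span_insert span_singleton)
    then have v: "v = w + a *\<^sub>R \<oo> + b *\<^sub>R \<qq>"
      by (simp add: algebra_simps)
    show ?thesis
      using w unfolding affine_model_iff[OF B(1)] affine_proj_def v by (simp add: bil oq qo)
  qed
  ultimately show ?thesis by blast
qed

definition circular ::
  "(real ^ 'n \<Rightarrow> real ^ 'n \<Rightarrow> real) \<Rightarrow> real ^ 'n \<Rightarrow> real ^ 'n \<Rightarrow> ('m::finite) lattice set \<Rightarrow>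
   ('m lattice \<Rightarrow> real ^ 'n) \<Rightarrow> bool" where
  "circular B \<oo> \<qq> \<Sigma> x \<longleftrightarrow> (\<forall>i j k l. quadrilateral \<Sigma> i j k l \<longrightarrow>
     \<not> collinear {x i, x j, x k, x l} \<and> quad_dim (\<lambda>n. inv_stereo B \<oo> \<qq> (x n)) i j k l = 3)"

text \<open>Being parallel presupposes non-degenerate edges. This matters only for edges on no
  quadrilateral: on a quadrilateral, regularity already excludes coinciding vertices.\<close>

definition edge_parallel ::
  "('m::finite) lattice set \<Rightarrow> ('m lattice \<Rightarrow> real ^ 'n) \<Rightarrow> ('m lattice \<Rightarrow> real ^ 'n) \<Rightarrow> bool" where
  "edge_parallel \<Sigma> x y \<longleftrightarrow> (\<forall>i j. edge \<Sigma> i j \<longrightarrow>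
     diff1 x i j \<noteq> 0 \<and> (\<exists>r. r \<noteq> 0 \<and> diff1 y i j = r *\<^sub>R diff1 x i j))"

definition koenigs_dual ::
  "(real ^ 'n \<Rightarrow> real ^ 'n \<Rightarrow> real) \<Rightarrow> real ^ 'n \<Rightarrow> real ^ 'n \<Rightarrow> ('m::finite) lattice set \<Rightarrow>
   ('m lattice \<Rightarrow> real ^ 'n) \<Rightarrow> ('m lattice \<Rightarrow> real ^ 'n) \<Rightarrow> bool" where
  "koenigs_dual B \<oo> \<qq> \<Sigma> x y \<longleftrightarrow> y \<in> \<Sigma> \<rightarrow> affine_model B \<oo> \<qq> \<and> edge_parallel \<Sigma> x y \<and>
     (\<forall>i j k l. quadrilateral \<Sigma> i j k l \<longrightarrow> curly_wedge (diff1 x) (diff1 y) l k j i = 0)"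

definition christoffel_dual ::
  "(real ^ 'n \<Rightarrow> real ^ 'n \<Rightarrow> real) \<Rightarrow> real ^ 'n \<Rightarrow> real ^ 'n \<Rightarrow> ('m::finite) lattice set \<Rightarrow>
   ('m lattice \<Rightarrow> real ^ 'n) \<Rightarrow> ('m lattice \<Rightarrow> real ^ 'n) \<Rightarrow> bool" where
  "christoffel_dual B \<oo> \<qq> \<Sigma> x y \<longleftrightarrow> circular B \<oo> \<qq> \<Sigma> x \<and> koenigs_dual B \<oo> \<qq> \<Sigma> x y"

definition form_of_dual ::
  "(real ^ 'n \<Rightarrow> real ^ 'n \<Rightarrow> real) \<Rightarrow> real ^ 'n \<Rightarrow> real ^ 'n \<Rightarrow> ('m::finite) lattice set \<Rightarrow>
   ('m lattice \<Rightarrow> (real ^ 'n) set) \<Rightarrow> ('m lattice \<Rightarrow> 'm lattice \<Rightarrow> real ^ 'n ^ 'n) \<Rightarrow>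
   ('m lattice \<Rightarrow> real ^ 'n) \<Rightarrow> bool" where
  "form_of_dual B \<oo> \<qq> \<Sigma> s \<eta> y \<longleftrightarrow> isothermic_form \<Sigma> s \<eta> \<and>
     (\<forall>i j. edge \<Sigma> i j \<longrightarrow> diff1 y j i = affine_proj B \<oo> \<qq> (act B (\<eta> j i) \<qq>))"

end

theory Submission
  imports Defs
begin

text \<open>On a quadrilateral of a circular net everything reduces to one linear relation. Represent a point
  \<open>x\<close> of the affine model by the null vector \<open>\<sigma> = \<oo> + x + (x, x)/2 \<qq>\<close>. The four null
  vectors of a circular quadrilateral span a space of dimension three, and as the diagonals are
  non-isotropic any three of them are independent; hence
  \<open>\<sigma>\<^sub>k = a \<sigma>\<^sub>i + b \<sigma>\<^sub>j + d \<sigma>\<^sub>l\<close> with \<open>a + b + d = 1\<close> and \<open>a, b, d\<close> non-zero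
  (\<open>circle_coeffs_exist\<close>).

  A form \<open>\<eta>\<close> with \<open>\<eta>\<^sub>j\<^sub>i \<in> s\<^sub>j \<and> s\<^sub>i\<close> is given by a symmetric non-zero factor on each edge,
  \<open>\<eta>\<^sub>j\<^sub>i = c\<^sub>j\<^sub>i \<sigma>\<^sub>j \<and> \<sigma>\<^sub>i\<close>. Applying it to \<open>\<qq>\<close> and projecting gives \<open>c\<^sub>j\<^sub>i (x\<^sub>j - x\<^sub>i)\<close>: the
  factors of \<open>\<eta>\<close> are the factors by which a dual net stretches the edges of \<open>x\<close>. Write
  \<open>c1, c2, c3, c4\<close> for the factors on \<open>ij, jk, kl, li\<close>. Closedness of \<open>c dx\<close> leaves a
  two-dimensional space of factors, and on it both the circulation of \<open>\<eta>\<close> and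
  \<open>dx \<curlywedge> dy\<close> are multiples, by the same number \<open>b c3 + d c2\<close> up to sign, of a non-zero bivector.
  Hence \<open>\<eta>\<close> is closed exactly if \<open>c dx\<close> is closed and the Koenigs condition holds, and in either
  case the factors lie on the line through \<open>(-a b, -b, d, a d)\<close> (\<open>balanced\<close>). One direction of the
  equivalence then follows from this alone; the other needs in addition the discrete Poincare lemma
  \<open>closed_form_has_primitive\<close>, which integrates \<open>\<pi>(\<eta> \<qq>)\<close> to a net.

  For factors on that line, the dual quadrilateral is again circular, with coefficients
  \<open>1/a, -d/a, -b/a\<close>, and its diagonals are multiples of the opposite diagonals of the original
  (\<open>dual_circle_coeffs\<close>). So the dual net has a regular lift, and since the Koenigs condition is
  symmetric in the two nets, that lift is isothermic by the equivalence with the roles exchanged.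

  Because the admissible factors form a line on each quadrilateral, the quotient of the factors of two
  duals is constant along chains of edges in common quadrilaterals, which is the uniqueness statement.\<close>

section \<open>Summing closed 1-forms along edge-paths\<close>

lemma edge_sym: "edge \<Sigma> i j \<Longrightarrow> edge \<Sigma> j i"
  unfolding edge_def by blast

lemma quadrilateral_edges:
  assumes "quadrilateral \<Sigma> i j k l"
  shows "edge \<Sigma> i j" "edge \<Sigma> j k" "edge \<Sigma> k l" "edge \<Sigma> l i"
proof -
  have neg: "axis a (-1) = - axis a (1::int)" for a :: 'a
    by (simp add: vec_eq_iff axis_def)
  obtain a b \<sigma> \<tau> where sub: "{i, j, k, l} \<subseteq> \<Sigma>" and \<sigma>: "\<sigma> = 1 \<or> \<sigma> = -1" and \<tau>: "\<tau> = 1 \<or> \<tau> = -1"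
    and j: "j = i + axis a \<sigma>" and k: "k = i + axis a \<sigma> + axis b \<tau>" and l: "l = i + axis b \<tau>"
    using assms unfolding quadrilateral_def by blast
  have "\<exists>e. axis a \<sigma> = axis e 1 \<or> - axis a \<sigma> = axis e 1" "\<exists>e. axis b \<tau> = axis e 1 \<or> - axis b \<tau> = axis e 1"
    using \<sigma> \<tau> by (auto simp: neg)
  with sub show "edge \<Sigma> i j" "edge \<Sigma> j k" "edge \<Sigma> k l" "edge \<Sigma> l i"
    unfolding edge_def j k l by (auto simp: algebra_simps)
qed

fun path_sum :: "('m lattice \<Rightarrow> 'm lattice \<Rightarrow> 'v::real_vector) \<Rightarrow> 'm lattice list \<Rightarrow> 'v" where
  "path_sum \<alpha> (i # j # ps) = \<alpha> j i + path_sum \<alpha> (j # ps)"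
| "path_sum \<alpha> [i] = 0"
| "path_sum \<alpha> [] = 0"

lemma path_sum_append: "path_sum \<alpha> (ps @ i # qs) = path_sum \<alpha> (ps @ [i]) + path_sum \<alpha> (i # qs)"
proof (induction ps)
  case (Cons h ps)
  then show ?case by (cases ps) (auto simp: algebra_simps)
qed simp

text \<open>A spike contributes two opposite terms; a flip exchanges two halves of a closed circuit.\<close>

lemma path_sum_move:
  assumes "path_move \<Sigma> ps qs" "one_form \<Sigma> \<alpha>" "closed_form \<Sigma> \<alpha>"
  shows "path_sum \<alpha> ps = path_sum \<alpha> qs"
  using assms(1)
proof cases
  case (spike i j as bs)
  have "\<alpha> j i = - \<alpha> i j"
    using spike assms(2) unfolding one_form_def by blast
  then have "path_sum \<alpha> (i # j # i # bs) = path_sum \<alpha> (i # bs)" by simp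
  then show ?thesis
    using spike path_sum_append[of \<alpha> as i bs] path_sum_append[of \<alpha> as i "j # i # bs"] by simp
next
  case (flip i j k l as bs)
  note e = quadrilateral_edges[OF flip(3)]
  have "\<alpha> k j = - \<alpha> j k" "\<alpha> j i = - \<alpha> i j"
    using e assms(2) unfolding one_form_def by blast+
  then have "(\<alpha> l k + \<alpha> i l) - (\<alpha> j k + \<alpha> i j) = \<alpha> i l + \<alpha> l k + \<alpha> k j + \<alpha> j i"
    by simp
  also have "\<dots> = 0"
    using flip(3) assms(3) unfolding closed_form_def by blast
  finally have "\<alpha> l k + \<alpha> i l = \<alpha> j k + \<alpha> i j"
    by (simp only: right_minus_eq)
  then have "path_sum \<alpha> (k # l # i # bs) = path_sum \<alpha> (k # j # i # bs)"
    by (simp only: path_sum.simps add.assoc[symmetric])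
  then show ?thesis
    using flip path_sum_append[of \<alpha> as k "l # i # bs"] path_sum_append[of \<alpha> as k "j # i # bs"] by simp
qed

text \<open>The discrete Poincare lemma. The sum along a path depends only on its end-points, so that summing
  from a base point defines a primitive.\<close>

lemma closed_form_has_primitive:
  assumes dom: "simply_connected_domain \<Sigma>" and one: "one_form \<Sigma> \<alpha>" and closed: "closed_form \<Sigma> \<alpha>"
  obtains y where "\<And>i j. edge \<Sigma> i j \<Longrightarrow> diff1 y j i = \<alpha> j i"
proof (cases "\<Sigma> = {}")
  case True
  then show ?thesis using that[of "\<lambda>_. 0"] by (simp add: edge_def)
next
  case False
  then obtain b where b: "b \<in> \<Sigma>" by blast
  have "\<forall>i\<in>\<Sigma>. \<exists>ps. edge_path \<Sigma> ps \<and> hd ps = b \<and> last ps = i"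
    using dom b unfolding simply_connected_domain_def by blast
  then obtain P where P: "\<And>i. i \<in> \<Sigma> \<Longrightarrow> edge_path \<Sigma> (P i) \<and> hd (P i) = b \<and> last (P i) = i"
    by metis
  have indep: "path_sum \<alpha> ps = path_sum \<alpha> qs"
    if "edge_path \<Sigma> ps" "edge_path \<Sigma> qs" "hd ps = hd qs" "last ps = last qs" for ps qs
  proof -
    have "equivclp (path_move \<Sigma>) ps qs"
      using dom that unfolding simply_connected_domain_def by blast
    then show ?thesis
      by (induction rule: equivclp_induct) (use path_sum_move[OF _ one closed] in auto)
  qed
  show ?thesis
  proof (rule that[of "\<lambda>i. path_sum \<alpha> (P i)"])
    fix i j assume e: "edge \<Sigma> i j"
    then have i: "i \<in> \<Sigma>" and j: "j \<in> \<Sigma>" unfolding edge_def by auto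
    obtain ps where ps: "P i = ps @ [i]"
      using P[OF i] unfolding edge_path_def by (metis append_butlast_last_id)
    have "edge_path \<Sigma> (P i @ [j])"
      using P[OF i] e j unfolding edge_path_def by (auto simp: successively_append_iff)
    then have "path_sum \<alpha> (P i @ [j]) = path_sum \<alpha> (P j)"
      using indep[of "P i @ [j]" "P j"] P[OF i] P[OF j] unfolding edge_path_def by auto
    moreover have "path_sum \<alpha> (P i @ [j]) = path_sum \<alpha> (P i) + \<alpha> j i"
      using path_sum_append[of \<alpha> ps i "[j]"] ps by simp
    ultimately show "diff1 (\<lambda>i. path_sum \<alpha> (P i)) j i = \<alpha> j i"
      unfolding diff1_def using \<open>path_sum \<alpha> (P i @ [j]) = path_sum \<alpha> (P j)\<close>
      by (metis add_diff_cancel_left')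
  qed
qed

section \<open>Bivectors and linear independence\<close>

lemma wedge_scale: "wedge (s *\<^sub>R a) (t *\<^sub>R b) = (s * t) *\<^sub>R wedge a b"
  by (simp add: wedge_def vec_eq_iff algebra_simps)

lemma wedge_self: "wedge a a = 0"
  by (simp add: wedge_def vec_eq_iff)

lemma wedge_swap: "wedge b a = - wedge a b"
  by (simp add: wedge_def vec_eq_iff)

text \<open>For two lines this space is spanned by a single bivector, so a form of an isothermic net amounts to one number
  per edge.\<close>

lemma wedge_space_lines: "wedge_space (span {a}) (span {b}) = span {wedge a b}"
proof
  have "{wedge u v | u v. u \<in> span {a} \<and> v \<in> span {b}} \<subseteq> span {wedge a b}"
    by (auto simp: span_singleton wedge_scale)
  then show "wedge_space (span {a}) (span {b}) \<subseteq> span {wedge a b}"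
    unfolding wedge_space_def by (simp add: span_minimal)
  show "span {wedge a b} \<subseteq> wedge_space (span {a}) (span {b})"
    unfolding wedge_space_def by (intro span_mono) (auto intro: span_base)
qed

lemma wedge_combination:
  "wedge (p *\<^sub>R u + q *\<^sub>R v) (r *\<^sub>R u + s *\<^sub>R v) = (p * s - q * r) *\<^sub>R wedge u v"
  by (simp add: wedge_def vec_eq_iff algebra_simps)

lemma wedge_eq_0_dependent:
  assumes "wedge u v = 0"
  shows "u = 0 \<or> (\<exists>t. v = t *\<^sub>R u)"
proof (cases "u = 0")
  case False
  then obtain r where r: "u $ r \<noteq> 0" by (metis vec_eq_iff zero_index)
  have "u $ r * v $ c = u $ c * v $ r" for c
    using assms unfolding wedge_def by (simp add: vec_eq_iff)
  then have "v = (v $ r / u $ r) *\<^sub>R u"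
    using r by (simp add: vec_eq_iff field_simps)
  then show ?thesis by blast
qed simp

text \<open>Independence of a family of two vectors; independence of the set \<open>{u, v}\<close> would be weaker, as it
  allows \<open>u = v\<close>.\<close>

definition independent_pair :: "'v::real_vector \<Rightarrow> 'v \<Rightarrow> bool" where
  "independent_pair u v \<longleftrightarrow> (\<forall>\<alpha> \<beta>. \<alpha> *\<^sub>R u + \<beta> *\<^sub>R v = 0 \<longrightarrow> \<alpha> = 0 \<and> \<beta> = 0)"

lemma independent_pairD: "independent_pair u v \<Longrightarrow> \<alpha> *\<^sub>R u + \<beta> *\<^sub>R v = 0 \<Longrightarrow> \<alpha> = 0 \<and> \<beta> = 0"
  unfolding independent_pair_def by blast

lemma independent_pair_scale:
  "independent_pair u v \<Longrightarrow> \<alpha> \<noteq> 0 \<Longrightarrow> \<beta> \<noteq> 0 \<Longrightarrow> independent_pair (\<alpha> *\<^sub>R u) (\<beta> *\<^sub>R v)"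
  unfolding independent_pair_def by fastforce

lemma wedge_independent_pair:
  assumes "independent_pair u v"
  shows "wedge u v \<noteq> 0"
proof
  assume "wedge u v = 0"
  then consider "u = 0" | t where "v = t *\<^sub>R u" using wedge_eq_0_dependent by blast
  then show False
  proof cases
    case 1
    then show ?thesis using independent_pairD[OF assms, of 1 0] by simp
  next
    case (2 t)
    then show ?thesis using independent_pairD[OF assms, of t "-1"] by simp
  qed
qed

lemma independent_pair_linear_image:
  assumes "linear f" "independent_pair (f u) (f v)"
  shows "independent_pair u v"
  unfolding independent_pair_def
proof (intro allI impI)
  fix \<alpha> \<beta> assume "\<alpha> *\<^sub>R u + \<beta> *\<^sub>R v = 0"
  then have "f (\<alpha> *\<^sub>R u + \<beta> *\<^sub>R v) = 0" using linear_0[OF assms(1)] by simp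
  then show "\<alpha> = 0 \<and> \<beta> = 0"
    using independent_pairD[OF assms(2)] by (simp add: linear_add[OF assms(1)] linear_scale[OF assms(1)])
qed

lemma independent_triple:
  fixes u v w :: "'v::real_vector"
  assumes "\<And>\<alpha> \<beta> \<gamma>. \<alpha> *\<^sub>R u + \<beta> *\<^sub>R v + \<gamma> *\<^sub>R w = 0 \<Longrightarrow> \<alpha> = 0 \<and> \<beta> = 0 \<and> \<gamma> = 0"
  shows "independent {u, v, w}" "card {u, v, w} = 3"
proof -
  have u: "u \<notin> span {v, w}"
  proof
    assume "u \<in> span {v, w}"
    then obtain s t where "u - s *\<^sub>R v = t *\<^sub>R w" by (auto simp: span_insert span_singleton)
    then show False using assms[of 1 "- s" "- t"] by (simp add: algebra_simps)
  qed
  have v: "v \<notin> span {w}"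
  proof
    assume "v \<in> span {w}"
    then obtain t where "v = t *\<^sub>R w" by (auto simp: span_singleton)
    then show False using assms[of 0 1 "- t"] by simp
  qed
  have w: "w \<noteq> 0" using assms[of 0 0 1] by auto
  show "independent {u, v, w}"
    using u v w by (simp add: independent_insert)
  have "u \<noteq> v" "u \<noteq> w" "v \<noteq> w" using u v by (auto intro: span_base)
  then show "card {u, v, w} = 3" by simp
qed

lemma linear_act: "linear (\<lambda>\<omega>. act B \<omega> z)"
  unfolding act_def
  by (rule linearI) (simp_all add: vec_eq_iff sum.distrib sum_distrib_left algebra_simps)

section \<open>Circulation around a plane quadrilateral\<close>

text \<open>The conditions on the factors \<open>c1, c2, c3, c4\<close> of the edges \<open>ij, jk, kl, li\<close> of a
  quadrilateral with \<open>z\<^sub>k = a z\<^sub>i + b z\<^sub>j + d z\<^sub>l\<close>. For \<open>b \<noteq> 0\<close> the solutions form the line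
  spanned by \<open>(-a b, -b, d, a d)\<close>.\<close>

definition balanced ::
  "real \<Rightarrow> real \<Rightarrow> real \<Rightarrow> real \<Rightarrow> real \<Rightarrow> real \<Rightarrow> real \<Rightarrow> bool" where
  "balanced a b d c1 c2 c3 c4 \<longleftrightarrow> c1 = a * c2 \<and> c4 = a * c3 \<and> b * c3 + d * c2 = 0"

lemma balanced_unique:
  assumes "balanced a b d c1 c2 c3 c4" "balanced a b d e1 e2 e3 e4" "b \<noteq> 0" "c2 \<noteq> 0" "e2 \<noteq> 0"
  obtains r where "r \<noteq> 0" "e1 = r * c1" "e2 = r * c2" "e3 = r * c3" "e4 = r * c4"
proof -
  have "b * (e3 * c2 - e2 * c3) = c2 * (b * e3 + d * e2) - e2 * (b * c3 + d * c2)"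
    by (simp add: algebra_simps)
  then have "e3 * c2 = e2 * c3"
    using assms unfolding balanced_def by simp
  then show ?thesis
    using that[of "e2 / c2"] assms unfolding balanced_def by (simp add: field_simps)
qed

text \<open>In the basis \<open>z\<^sub>j - z\<^sub>i\<close>, \<open>z\<^sub>l - z\<^sub>i\<close> closedness amounts to two linear equations for the four
  factors. The common excess \<open>b c3 + d c2\<close> of \<open>c1\<close> and \<open>c4\<close> over their balanced
  values is what closedness of \<open>c dz\<close> leaves undetermined.\<close>

lemma closed_quad_iff:
  fixes zi :: "'v::real_vector"
  assumes ind: "independent_pair (zj - zi) (zl - zi)"
    and zk: "zk = a *\<^sub>R zi + b *\<^sub>R zj + d *\<^sub>R zl" and abd: "a + b + d = 1"
  shows "c4 *\<^sub>R (zi - zl) + c3 *\<^sub>R (zl - zk) + c2 *\<^sub>R (zk - zj) + c1 *\<^sub>R (zj - zi) = 0 \<longleftrightarrow>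
    c1 = a * c2 + (b * c3 + d * c2) \<and> c4 = a * c3 + (b * c3 + d * c2)"
proof -
  have a: "a = 1 - b - d" using abd by simp
  have "c4 *\<^sub>R (zi - zl) + c3 *\<^sub>R (zl - zk) + c2 *\<^sub>R (zk - zj) + c1 *\<^sub>R (zj - zi) =
    (c1 - (a * c2 + (b * c3 + d * c2))) *\<^sub>R (zj - zi) + ((a * c3 + (b * c3 + d * c2)) - c4) *\<^sub>R (zl - zi)"
    unfolding zk a by (simp add: algebra_simps)
  moreover have "\<alpha> *\<^sub>R (zj - zi) + \<beta> *\<^sub>R (zl - zi) = 0 \<longleftrightarrow> \<alpha> = 0 \<and> \<beta> = 0" for \<alpha> \<beta>
    using independent_pairD[OF ind] by auto
  ultimately show ?thesis by auto
qed

text \<open>The excess left free by \<open>closed_quad_iff\<close> reappears as the coefficient of the circulation of the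
  bivectors. It does not depend on the origin, because the vectors \<open>c dz\<close> sum to zero.\<close>

lemma wedge_circulation:
  assumes zk: "zk = a *\<^sub>R zi + b *\<^sub>R zj + d *\<^sub>R zl" and abd: "a + b + d = 1"
    and c: "c1 = a * c2 + (b * c3 + d * c2)" "c4 = a * c3 + (b * c3 + d * c2)"
  shows "c4 *\<^sub>R wedge zi zl + c3 *\<^sub>R wedge zl zk + c2 *\<^sub>R wedge zk zj + c1 *\<^sub>R wedge zj zi =
    - (b * c3 + d * c2) *\<^sub>R wedge (zj - zi) (zl - zi)"
proof -
  have a: "a = 1 - b - d" using abd by simp
  show ?thesis
    unfolding zk c a by (simp add: wedge_def vec_eq_iff algebra_simps)
qed

text \<open>For a net \<open>y\<close> whose edges are the multiples \<open>c1, c2, c4\<close> of those of \<open>x\<close>, the mixed area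
  \<open>dx \<curlywedge> dy\<close> measures the same excess as the circulation of the bivectors in
  \<open>wedge_circulation\<close>. This is why the Koenigs condition on \<open>x\<close> is the closedness condition on
  its lift.\<close>

lemma curly_wedge_circulation:
  assumes zk: "x k = a *\<^sub>R x i + b *\<^sub>R x j + d *\<^sub>R x l" and abd: "a + b + d = 1"
    and c: "c1 = a * c2 + (b * c3 + d * c2)" "c4 = a * c3 + (b * c3 + d * c2)"
    and y: "y j = y i + c1 *\<^sub>R (x j - x i)" "y k = y j + c2 *\<^sub>R (x k - x j)"
      "y l = y i + c4 *\<^sub>R (x l - x i)"
  shows "curly_wedge (diff1 x) (diff1 y) l k j i = (b * c3 + d * c2) *\<^sub>R wedge (x j - x i) (x l - x i)"
proof -
  define u v where "u = x j - x i" and "v = x l - x i"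
  have a: "a = 1 - b - d" using abd by simp
  have xj: "x j = x i + u" and xl: "x l = x i + v" and xk: "x k = x i + b *\<^sub>R u + d *\<^sub>R v"
    unfolding u_def v_def zk a by (simp_all add: algebra_simps)
  have yj: "y j = y i + c1 *\<^sub>R u" and yl: "y l = y i + c4 *\<^sub>R v"
    and yk: "y k = y i + (c1 + c2 * (b - 1)) *\<^sub>R u + (c2 * d) *\<^sub>R v"
    unfolding y(2) unfolding y(1,3) xj xl xk by (simp_all add: algebra_simps)
  have "(x j - x i) + (x k - x l) = (1 + b) *\<^sub>R u + (d - 1) *\<^sub>R v"
    "(x l - x i) + (x k - x j) = (b - 1) *\<^sub>R u + (1 + d) *\<^sub>R v"
    "(y j - y i) + (y k - y l) = (c1 + c1 + c2 * (b - 1)) *\<^sub>R u + (c2 * d - c4) *\<^sub>R v"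
    "(y l - y i) + (y k - y j) = (c2 * (b - 1)) *\<^sub>R u + (c4 + c2 * d) *\<^sub>R v"
    unfolding xj xl xk yj yl yk by (simp_all add: vec_eq_iff algebra_simps)
  then have "curly_wedge (diff1 x) (diff1 y) l k j i = (1/4 *
      ((1 + b) * (c4 + c2 * d) - (d - 1) * (c2 * (b - 1)) -
       ((b - 1) * (c2 * d - c4) - (1 + d) * (c1 + c1 + c2 * (b - 1))))) *\<^sub>R wedge u v"
    unfolding curly_wedge_def diff1_def by (simp add: wedge_combination flip: scaleR_diff_left)
  also have "1/4 * ((1 + b) * (c4 + c2 * d) - (d - 1) * (c2 * (b - 1)) -
       ((b - 1) * (c2 * d - c4) - (1 + d) * (c1 + c1 + c2 * (b - 1)))) = b * c3 + d * c2"
    unfolding c a by (simp add: field_simps)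
  finally show ?thesis unfolding u_def v_def .
qed

section \<open>Stereoprojection and circular quadrilaterals\<close>

locale stereo_frame =
  fixes B :: "real ^ 'n \<Rightarrow> real ^ 'n \<Rightarrow> real" and \<oo> \<qq> :: "real ^ 'n"
  assumes bilinear: "bilinear B" and sym: "B v w = B w v"
    and oo: "B \<oo> \<oo> = 0" and qq: "B \<qq> \<qq> = 0" and oq: "B \<oo> \<qq> = -1"
begin

lemma qo: "B \<qq> \<oo> = -1"
  using sym oq by metis

lemma q_nonzero: "\<qq> \<noteq> 0"
  using oq bilinear_rzero[OF bilinear] by force

lemmas expand =
  bilinear_ladd[OF bilinear] bilinear_radd[OF bilinear] bilinear_lmul[OF bilinear]
  bilinear_rmul[OF bilinear] bilinear_lsub[OF bilinear] bilinear_rsub[OF bilinear]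
  bilinear_lneg[OF bilinear] bilinear_rneg[OF bilinear] oo qq oq qo

abbreviation affine_part :: "(real ^ 'n) set" where
  "affine_part \<equiv> affine_model B \<oo> \<qq>"

abbreviation proj :: "real ^ 'n \<Rightarrow> real ^ 'n" where
  "proj \<equiv> affine_proj B \<oo> \<qq>"

text \<open>The representative of the inverse stereoprojection with product \<open>-1\<close> with \<open>\<qq>\<close>. With this
  normalisation the coefficients of a linear relation between lifts sum to zero.\<close>

definition lift :: "real ^ 'n \<Rightarrow> real ^ 'n" where
  "lift x = \<oo> + x + (1/2 * B x x) *\<^sub>R \<qq>"

lemma inv_stereo_lift: "inv_stereo B \<oo> \<qq> x = span {lift x}"
  unfolding inv_stereo_def lift_def ..

lemma affine_part_form:
  assumes "x \<in> affine_part"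
  shows "B x \<oo> = 0" "B x \<qq> = 0" "B \<oo> x = 0" "B \<qq> x = 0"
  using assms sym[of \<oo> x] sym[of \<qq> x] unfolding affine_model_iff[OF bilinear] by auto

lemma subspace_affine_part: "subspace affine_part"
  unfolding subspace_def by (auto simp: affine_model_iff[OF bilinear] expand bilinear_lzero[OF bilinear])

lemma linear_proj: "linear proj"
  unfolding affine_proj_def by (rule linearI) (simp_all add: expand algebra_simps)

lemma proj_in_affine_part: "proj v \<in> affine_part"
  unfolding affine_model_iff[OF bilinear] affine_proj_def by (simp add: expand)

lemma proj_affine_part: "x \<in> affine_part \<Longrightarrow> proj x = x"
  unfolding affine_proj_def by (simp add: affine_part_form)

lemma proj_lift: "x \<in> affine_part \<Longrightarrow> proj (lift x) = x"
  unfolding affine_proj_def lift_def by (simp add: expand affine_part_form)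

lemma form_lift_q: "x \<in> affine_part \<Longrightarrow> B (lift x) \<qq> = -1"
  unfolding lift_def by (simp add: expand affine_part_form)

text \<open>So a diagonal is isotropic in the quadric exactly if its difference vector is null in the affine
  model.\<close>

lemma form_lift:
  assumes "x \<in> affine_part" "y \<in> affine_part"
  shows "B (lift x) (lift y) = - (1/2) * B (x - y) (x - y)"
  unfolding lift_def
  using sym[of x y] by (simp add: expand affine_part_form[OF assms(1)] affine_part_form[OF assms(2)] algebra_simps)

lemma lift_null: "x \<in> affine_part \<Longrightarrow> B (lift x) (lift x) = 0"
  by (simp add: form_lift bilinear_lzero[OF bilinear])

lemma span_lift_inj:
  assumes "x \<in> affine_part" "y \<in> affine_part" "span {lift x} = span {lift y}"
  shows "x = y"
proof -
  have "lift x \<in> span {lift y}" using assms(3) span_base by blast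
  then obtain c where c: "lift x = c *\<^sub>R lift y" by (auto simp: span_singleton)
  have "B (lift x) \<qq> = c * B (lift y) \<qq>" unfolding c by (simp add: expand)
  then have "c = 1" using assms form_lift_q by simp
  then show ?thesis using c assms proj_lift by (metis scaleR_one)
qed

lemma lift_in_quadric:
  assumes x: "x \<in> affine_part"
  shows "span {lift x} \<in> quadric B - projectivize (light_cone B \<inter> perp B {\<qq>})"
proof -
  have nz: "lift x \<noteq> 0" using form_lift_q[OF x] bilinear_lzero[OF bilinear] by force
  then have "span {lift x} \<in> quadric B"
    unfolding quadric_def projectivize_def light_cone_def using lift_null[OF x] by blast
  moreover have "span {lift x} \<notin> projectivize (light_cone B \<inter> perp B {\<qq>})"
  proof
    assume "span {lift x} \<in> projectivize (light_cone B \<inter> perp B {\<qq>})"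
    then obtain v where v: "span {lift x} = span {v}" "B v \<qq> = 0"
      unfolding projectivize_def perp_def by auto
    then have "lift x \<in> span {v}" using span_base by blast
    then obtain c where "lift x = c *\<^sub>R v" by (auto simp: span_singleton)
    then have "B (lift x) \<qq> = 0" using v(2) by (simp add: expand)
    then show False using form_lift_q[OF x] by simp
  qed
  ultimately show ?thesis by blast
qed

lemma form_orthogonal_lift: "form_orthogonal B (span {lift x}) (span {lift y}) \<longleftrightarrow> B (lift x) (lift y) = 0"
proof
  assume "form_orthogonal B (span {lift x}) (span {lift y})"
  then show "B (lift x) (lift y) = 0" unfolding form_orthogonal_def by (simp add: span_base)
next
  assume "B (lift x) (lift y) = 0"
  then show "form_orthogonal B (span {lift x}) (span {lift y})"
    unfolding form_orthogonal_def by (auto simp: span_singleton expand)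
qed

lemma lift_pair_independent:
  assumes "x \<in> affine_part" "y \<in> affine_part" "\<alpha> *\<^sub>R lift x + \<beta> *\<^sub>R lift y = 0" "x \<noteq> y"
  shows "\<alpha> = 0 \<and> \<beta> = 0"
proof -
  have "B (\<alpha> *\<^sub>R lift x + \<beta> *\<^sub>R lift y) \<qq> = - \<alpha> - \<beta>"
    using form_lift_q assms(1,2) by (simp add: expand)
  then have \<alpha>: "\<alpha> = - \<beta>" using assms(3) bilinear_lzero[OF bilinear] by simp
  have "proj (\<alpha> *\<^sub>R lift x + \<beta> *\<^sub>R lift y) = \<alpha> *\<^sub>R x + \<beta> *\<^sub>R y"
    by (simp add: linear_add[OF linear_proj] linear_scale[OF linear_proj] proj_lift assms(1,2))
  then have "\<alpha> *\<^sub>R x + \<beta> *\<^sub>R y = 0"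
    unfolding assms(3) linear_0[OF linear_proj] by simp
  then have "\<beta> *\<^sub>R (y - x) = 0"
    unfolding \<alpha> by (simp add: algebra_simps)
  then show ?thesis using assms(4) \<alpha> by simp
qed

text \<open>A plane spanned by two non-orthogonal null vectors contains no null lines but their own.\<close>

lemma null_triple_independent:
  assumes A: "x \<in> affine_part" "y \<in> affine_part" "z \<in> affine_part" and ne: "x \<noteq> y" "x \<noteq> z"
    and yz: "B (lift y) (lift z) \<noteq> 0"
    and zero: "\<alpha> *\<^sub>R lift x + \<beta> *\<^sub>R lift y + \<gamma> *\<^sub>R lift z = 0"
  shows "\<alpha> = 0 \<and> \<beta> = 0 \<and> \<gamma> = 0"
proof -
  \<comment> \<open>As the left-hand side is null, so is the combination on the right.\<close>
  have "\<alpha> *\<^sub>R lift x = - (\<beta> *\<^sub>R lift y + \<gamma> *\<^sub>R lift z)"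
    using zero by (metis add.assoc eq_neg_iff_add_eq_0)
  then have "B (\<alpha> *\<^sub>R lift x) (\<alpha> *\<^sub>R lift x) = B (\<beta> *\<^sub>R lift y + \<gamma> *\<^sub>R lift z) (\<beta> *\<^sub>R lift y + \<gamma> *\<^sub>R lift z)"
    by (simp only: bilinear_lneg[OF bilinear] bilinear_rneg[OF bilinear] minus_minus)
  then have "2 * \<beta> * \<gamma> * B (lift y) (lift z) = 0"
    by (simp add: expand lift_null A sym[of "lift z" "lift y"])
  then consider "\<beta> = 0" | "\<gamma> = 0" using yz by auto
  then show ?thesis
  proof cases
    case 1
    then show ?thesis using lift_pair_independent[OF A(1,3)] zero ne by simp
  next
    case 2
    then show ?thesis using lift_pair_independent[OF A(1,2)] zero ne by simp
  qed
qed

text \<open>The relation between the lifts of the vertices of a circular quadrilateral. Independence of the two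
  sides at \<open>x\<^sub>i\<close> is recorded in the affine model, where it expresses that the vertices are not
  collinear and from where it passes to the lifts by projection.\<close>

definition circle_coeffs ::
  "real \<Rightarrow> real \<Rightarrow> real \<Rightarrow> real ^ 'n \<Rightarrow> real ^ 'n \<Rightarrow> real ^ 'n \<Rightarrow> real ^ 'n \<Rightarrow> bool" where
  "circle_coeffs a b d xi xj xk xl \<longleftrightarrow> a \<noteq> 0 \<and> b \<noteq> 0 \<and> d \<noteq> 0 \<and> a + b + d = 1 \<and>
     independent_pair (xj - xi) (xl - xi) \<and>
     lift xk = a *\<^sub>R lift xi + b *\<^sub>R lift xj + d *\<^sub>R lift xl"

lemma span_of_spans: "span (span {u} \<union> span {v} \<union> span {w} \<union> span {z}) = span {u, v, w, z}"
proof -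
  have "span {y} \<subseteq> span {u, v, w, z}" if "y \<in> {u, v, w, z}" for y
    using that by (intro span_mono) auto
  then show ?thesis
    unfolding span_eq by (auto intro!: span_base intro: span_base)
qed

text \<open>Each triple of vertices contains the end-points of a diagonal, so any three lifts are independent
  by \<open>null_triple_independent\<close>. This gives the relation in dimension three and excludes vanishing
  coefficients.\<close>

lemma circle_coeffs_exist:
  assumes A: "xi \<in> affine_part" "xj \<in> affine_part" "xk \<in> affine_part" "xl \<in> affine_part"
    and ne: "xi \<noteq> xj" "xi \<noteq> xl" "xk \<noteq> xj" "xk \<noteq> xl"
    and diag: "B (lift xi) (lift xk) \<noteq> 0" "B (lift xj) (lift xl) \<noteq> 0"
    and planar: "dim {lift xi, lift xj, lift xk, lift xl} \<le> 3"
    and ncol: "\<not> collinear {xi, xj, xk, xl}"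
  obtains a b d where "circle_coeffs a b d xi xj xk xl"
proof -
  have ind: "independent {lift xi, lift xj, lift xl}" "card {lift xi, lift xj, lift xl} = 3"
    using independent_triple[OF null_triple_independent[OF A(1,2,4) ne(1,2) diag(2)]] by auto
  have "lift xk \<in> span {lift xi, lift xj, lift xl}"
  proof (rule ccontr)
    assume k: "lift xk \<notin> span {lift xi, lift xj, lift xl}"
    then have "independent {lift xk, lift xi, lift xj, lift xl}"
      using ind(1) by (auto simp: independent_insert)
    moreover have "card {lift xk, lift xi, lift xj, lift xl} = 4"
      using ind(2) k span_base[of "lift xk" "{lift xi, lift xj, lift xl}"] by (subst card_insert_disjoint) auto
    ultimately have "dim {lift xk, lift xi, lift xj, lift xl} = 4"
      by (metis dim_eq_card_independent)
    then show False using planar by (simp add: insert_commute)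
  qed
  then obtain a b d where "lift xk - a *\<^sub>R lift xi - b *\<^sub>R lift xj = d *\<^sub>R lift xl"
    by (auto simp: span_insert span_singleton)
  then have k: "lift xk = a *\<^sub>R lift xi + b *\<^sub>R lift xj + d *\<^sub>R lift xl"
    by (simp add: algebra_simps)
  have "B (lift xk) \<qq> = a * B (lift xi) \<qq> + b * B (lift xj) \<qq> + d * B (lift xl) \<qq>"
    unfolding k by (simp add: expand)
  then have abd: "a + b + d = 1" by (simp add: form_lift_q A)
  have "a \<noteq> 0"
    using null_triple_independent[OF A(3,2,4) ne(3,4) diag(2), of "-1" b d] k by auto
  moreover have "b \<noteq> 0"
    using null_triple_independent[OF A(4,1,3) ne(2,4)[symmetric] diag(1), of d a "-1"] k by auto
  moreover have "d \<noteq> 0"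
    using null_triple_independent[OF A(2,1,3) ne(1,3)[symmetric] diag(1), of b a "-1"] k by auto
  moreover have "independent_pair (xj - xi) (xl - xi)"
  proof (rule ccontr)
    assume "\<not> independent_pair (xj - xi) (xl - xi)"
    then obtain \<alpha> \<beta> where z: "\<alpha> *\<^sub>R (xj - xi) + \<beta> *\<^sub>R (xl - xi) = 0" and "\<alpha> \<noteq> 0 \<or> \<beta> \<noteq> 0"
      unfolding independent_pair_def by blast
    have "\<exists>w s t. xj - xi = s *\<^sub>R w \<and> xl - xi = t *\<^sub>R w"
    proof (cases "\<alpha> = 0")
      case True
      then have "xl - xi = 0 *\<^sub>R (xj - xi)" using z \<open>\<alpha> \<noteq> 0 \<or> \<beta> \<noteq> 0\<close> by simp
      then show ?thesis by (metis scaleR_one)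
    next
      case False
      have "\<alpha> *\<^sub>R (xj - xi) = (- \<beta>) *\<^sub>R (xl - xi)" using z by (simp add: add_eq_0_iff2)
      then have "xj - xi = (- \<beta> / \<alpha>) *\<^sub>R (xl - xi)"
        using False by (metis divide_inverse_commute scaleR_scaleR scaleR_one left_inverse)
      then show ?thesis by (metis scaleR_one)
    qed
    then obtain w s t where w: "xj - xi = s *\<^sub>R w" "xl - xi = t *\<^sub>R w" by blast
    have "proj (lift xk) = a *\<^sub>R proj (lift xi) + b *\<^sub>R proj (lift xj) + d *\<^sub>R proj (lift xl)"
      unfolding k by (simp add: linear_add[OF linear_proj] linear_scale[OF linear_proj])
    then have "xk = a *\<^sub>R xi + b *\<^sub>R xj + d *\<^sub>R xl" by (simp add: proj_lift A)
    also have "\<dots> = (a + b + d) *\<^sub>R xi + b *\<^sub>R (xj - xi) + d *\<^sub>R (xl - xi)"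
      by (simp add: algebra_simps)
    finally have xk: "xk = xi + (b * s + d * t) *\<^sub>R w"
      unfolding w abd by (simp add: algebra_simps)
    have xj: "xj = xi + s *\<^sub>R w" and xl: "xl = xi + t *\<^sub>R w" and xi: "xi = xi + 0 *\<^sub>R w"
      using w by (simp_all add: algebra_simps)
    have "collinear {xi, xj, xk, xl}"
      unfolding collinear_alt using xi xj xk xl by blast
    then show False using ncol by contradiction
  qed
  ultimately show ?thesis using that k abd unfolding circle_coeffs_def by blast
qed

lemma circle_coeffs_affine:
  assumes "circle_coeffs a b d xi xj xk xl"
    and A: "xi \<in> affine_part" "xj \<in> affine_part" "xk \<in> affine_part" "xl \<in> affine_part"
  shows "xk = a *\<^sub>R xi + b *\<^sub>R xj + d *\<^sub>R xl"
proof -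
  have "proj (lift xk) = proj (a *\<^sub>R lift xi + b *\<^sub>R lift xj + d *\<^sub>R lift xl)"
    using assms(1) unfolding circle_coeffs_def by simp
  then show ?thesis
    by (simp add: linear_add[OF linear_proj] linear_scale[OF linear_proj] proj_lift A)
qed

text \<open>The \<open>\<oo>\<close>-component and the affine component of the relation hold for any affine combination. What
  remains is the \<open>\<qq>\<close>-component, which does not change under translations: it says that the fourth
  point lies on the circle through \<open>x\<close>, \<open>x + u\<close> and \<open>x + v\<close>.\<close>

lemma lift_combination_iff:
  "lift (x + b *\<^sub>R u + d *\<^sub>R v) = (1 - b - d) *\<^sub>R lift x + b *\<^sub>R lift (x + u) + d *\<^sub>R lift (x + v) \<longleftrightarrow>
    B (b *\<^sub>R u + d *\<^sub>R v) (b *\<^sub>R u + d *\<^sub>R v) = b * B u u + d * B v v"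
proof -
  have "lift (x + b *\<^sub>R u + d *\<^sub>R v) - ((1 - b - d) *\<^sub>R lift x + b *\<^sub>R lift (x + u) + d *\<^sub>R lift (x + v)) =
    (1/2 * (B (x + b *\<^sub>R u + d *\<^sub>R v) (x + b *\<^sub>R u + d *\<^sub>R v) - (1 - b - d) * B x x -
      b * B (x + u) (x + u) - d * B (x + v) (x + v))) *\<^sub>R \<qq>"
    unfolding lift_def by (simp add: vec_eq_iff field_simps)
  also have "B (x + b *\<^sub>R u + d *\<^sub>R v) (x + b *\<^sub>R u + d *\<^sub>R v) - (1 - b - d) * B x x -
      b * B (x + u) (x + u) - d * B (x + v) (x + v) =
    B (b *\<^sub>R u + d *\<^sub>R v) (b *\<^sub>R u + d *\<^sub>R v) - (b * B u u + d * B v v)"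
    using sym[of u x] sym[of v x] sym[of v u] by (simp add: expand algebra_simps)
  finally have *: "lift (x + b *\<^sub>R u + d *\<^sub>R v) -
      ((1 - b - d) *\<^sub>R lift x + b *\<^sub>R lift (x + u) + d *\<^sub>R lift (x + v)) =
    (1/2 * (B (b *\<^sub>R u + d *\<^sub>R v) (b *\<^sub>R u + d *\<^sub>R v) - (b * B u u + d * B v v))) *\<^sub>R \<qq>" .
  show ?thesis
    by (subst right_minus_eq[symmetric], subst *) (simp add: q_nonzero)
qed

text \<open>With \<open>u = x\<^sub>j - x\<^sub>i\<close> and \<open>v = x\<^sub>l - x\<^sub>i\<close>, the balanced factors \<open>t (-a b, -b, d, a d)\<close> give a
  dual quadrilateral with sides \<open>-t a b u\<close> and \<open>t a d v\<close> and diagonal \<open>t b d (u - v)\<close>. The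
  circle condition \<open>(b u + d v, b u + d v) = b (u, u) + d (v, v)\<close> for the original quadrilateral is, up
  to a factor, the one for the dual.\<close>

lemma dual_circle_coeffs:
  assumes cc: "circle_coeffs a b d xi xj xk xl"
    and A: "xi \<in> affine_part" "xj \<in> affine_part" "xk \<in> affine_part" "xl \<in> affine_part"
    and bal: "balanced a b d c1 c2 c3 c4" and c2: "c2 \<noteq> 0"
    and y: "yj - yi = c1 *\<^sub>R (xj - xi)" "yk - yj = c2 *\<^sub>R (xk - xj)" "yl - yi = c4 *\<^sub>R (xl - xi)"
  shows "circle_coeffs (1 / a) (- d / a) (- b / a) yi yj yk yl"
    and "yk - yi = (d * c2) *\<^sub>R (xl - xj)" and "yl - yj = (- a * c2 / b) *\<^sub>R (xk - xi)"
proof -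
  define u v t where "u = xj - xi" and "v = xl - xi" and "t = - c2 / b"
  have nz: "a \<noteq> 0" "b \<noteq> 0" "d \<noteq> 0" and abd: "a + b + d = 1" and a: "a = 1 - b - d"
    and ind: "independent_pair u v"
    and xk0: "lift xk = a *\<^sub>R lift xi + b *\<^sub>R lift xj + d *\<^sub>R lift xl"
    using cc unfolding circle_coeffs_def u_def v_def by auto
  \<comment> \<open>The position of the factors on the line through \<open>(-a b, -b, d, a d)\<close>.\<close>
  have t: "t \<noteq> 0" "c2 = - b * t" "c1 = - a * b * t" "c4 = a * d * t"
    using bal nz c2 unfolding balanced_def t_def by (auto simp: field_simps add_eq_0_iff)
  have xj: "xj = xi + u" and xl: "xl = xi + v" and xk: "xk = xi + b *\<^sub>R u + d *\<^sub>R v"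
    unfolding u_def v_def circle_coeffs_affine[OF cc A] a by (simp_all add: algebra_simps)
  have yj: "yj = yi + (- a * b * t) *\<^sub>R u" and yl: "yl = yi + (a * d * t) *\<^sub>R v"
    using y t unfolding xj xl by (simp_all add: algebra_simps)
  have "yk = yj + c2 *\<^sub>R (xk - xj)" using y(2) by (simp add: algebra_simps)
  also have "\<dots> = yi + (b * d * t) *\<^sub>R u + (- b * d * t) *\<^sub>R v"
    unfolding yj xk xj t(2) a by (simp add: algebra_simps)
  finally have yk: "yk = yi + (b * d * t) *\<^sub>R u + (- b * d * t) *\<^sub>R v" .
  show "yk - yi = (d * c2) *\<^sub>R (xl - xj)"
    unfolding yk xl xj t(2) by (simp add: algebra_simps)
  have "- a * c2 / b = a * t" using t(2) nz by simp
  then show "yl - yj = (- a * c2 / b) *\<^sub>R (xk - xi)"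
    unfolding yl yj xk by (simp add: algebra_simps)
  define u' v' where "u' = (- a * b * t) *\<^sub>R u" and "v' = (a * d * t) *\<^sub>R v"
  have circ: "B (b *\<^sub>R u + d *\<^sub>R v) (b *\<^sub>R u + d *\<^sub>R v) = b * B u u + d * B v v"
    using xk0 unfolding lift_combination_iff[symmetric, where x = xi] xk xj xl a .
  have bu: "(- d / a) *\<^sub>R u' = (b * d * t) *\<^sub>R u" and dv: "(- b / a) *\<^sub>R v' = (- b * d * t) *\<^sub>R v"
    unfolding u'_def v'_def using nz by simp_all
  have "B ((- d / a) *\<^sub>R u' + (- b / a) *\<^sub>R v') ((- d / a) *\<^sub>R u' + (- b / a) *\<^sub>R v') =
      (b * d * t)\<^sup>2 * (B u u - 2 * B u v + B v v)"
    unfolding bu dv using sym[of v u] by (simp add: expand power2_eq_square algebra_simps)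
  also have "\<dots> = - (a * b * d * t\<^sup>2) * (b * B u u + d * B v v)"
  proof -
    have "b * d * (B u u - 2 * B u v + B v v) = - a * (b * B u u + d * B v v)"
      using circ sym[of v u] unfolding a by (simp add: expand algebra_simps)
    then have "(b * d * t\<^sup>2) * (b * d * (B u u - 2 * B u v + B v v)) = (b * d * t\<^sup>2) * (- a * (b * B u u + d * B v v))"
      by simp
    then show ?thesis by (simp add: power2_eq_square ac_simps)
  qed
  also have "\<dots> = (- d / a) * B u' u' + (- b / a) * B v' v'"
    unfolding u'_def v'_def using nz(1) by (simp add: expand power2_eq_square field_simps)
  finally have "lift (yi + (- d / a) *\<^sub>R u' + (- b / a) *\<^sub>R v') =
      (1 - - d / a - - b / a) *\<^sub>R lift yi + (- d / a) *\<^sub>R lift (yi + u') + (- b / a) *\<^sub>R lift (yi + v')"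
    unfolding lift_combination_iff .
  moreover have "1 - - d / a - - b / a = (a + b + d) / a"
    using nz(1) by (simp add: add_divide_distrib)
  ultimately have "lift yk = ((a + b + d) / a) *\<^sub>R lift yi + (- d / a) *\<^sub>R lift yj + (- b / a) *\<^sub>R lift yl"
    unfolding bu dv unfolding yk yj yl u'_def v'_def by simp
  then have "lift yk = (1 / a) *\<^sub>R lift yi + (- d / a) *\<^sub>R lift yj + (- b / a) *\<^sub>R lift yl"
    unfolding abd .
  moreover have "1 / a + - d / a + - b / a = (1 - d - b) / a"
    by (simp add: diff_divide_distrib)
  then have "1 / a + - d / a + - b / a = 1"
    using nz(1) a by simp
  moreover have "independent_pair (yj - yi) (yl - yi)"
    unfolding yj yl using independent_pair_scale[OF ind, of "- a * b * t" "a * d * t"] nz t(1) by simp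
  ultimately show "circle_coeffs (1 / a) (- d / a) (- b / a) yi yj yk yl"
    unfolding circle_coeffs_def using nz by simp
qed

lemma circle_coeffs_dim:
  assumes cc: "circle_coeffs a b d xi xj xk xl"
    and A: "xi \<in> affine_part" "xj \<in> affine_part" "xl \<in> affine_part"
  shows "dim {lift xi, lift xj, lift xk, lift xl} \<ge> 3"
proof -
  have "\<alpha> = 0 \<and> \<beta> = 0 \<and> \<gamma> = 0"
    if z: "\<alpha> *\<^sub>R lift xi + \<beta> *\<^sub>R lift xj + \<gamma> *\<^sub>R lift xl = 0" for \<alpha> \<beta> \<gamma>
  proof -
    have "B (\<alpha> *\<^sub>R lift xi + \<beta> *\<^sub>R lift xj + \<gamma> *\<^sub>R lift xl) \<qq> = - \<alpha> - \<beta> - \<gamma>"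
      by (simp add: expand form_lift_q A)
    then have \<alpha>: "\<alpha> = - \<beta> - \<gamma>" unfolding z by (simp add: bilinear_lzero[OF bilinear])
    have "proj (\<alpha> *\<^sub>R lift xi + \<beta> *\<^sub>R lift xj + \<gamma> *\<^sub>R lift xl) = \<beta> *\<^sub>R (xj - xi) + \<gamma> *\<^sub>R (xl - xi)"
      unfolding \<alpha> by (simp add: linear_add[OF linear_proj] linear_diff[OF linear_proj]
          linear_scale[OF linear_proj] proj_lift A algebra_simps)
    then have "\<beta> *\<^sub>R (xj - xi) + \<gamma> *\<^sub>R (xl - xi) = 0" unfolding z by (simp add: linear_0[OF linear_proj])
    then show ?thesis using cc independent_pairD \<alpha> unfolding circle_coeffs_def by fastforce
  qed
  then have "independent {lift xi, lift xj, lift xl}" "card {lift xi, lift xj, lift xl} = 3"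
    using independent_triple by blast+
  then have "dim {lift xi, lift xj, lift xl} = 3" by (metis dim_eq_card_independent)
  then show ?thesis
    using dim_subset[of "{lift xi, lift xj, lift xl}" "{lift xi, lift xj, lift xk, lift xl}"] by auto
qed

end

section \<open>Isothermic nets and Koenigs duals\<close>

text \<open>The factors of an edge-parallel net as a function on oriented edges. Being symmetric, they also
  serve as the coefficients of a form with values in \<open>s\<^sub>j \<and> s\<^sub>i\<close>.\<close>

definition edge_factor ::
  "('m::finite) lattice set \<Rightarrow> ('m lattice \<Rightarrow> real ^ 'n) \<Rightarrow> ('m lattice \<Rightarrow> real ^ 'n) \<Rightarrow>
   ('m lattice \<Rightarrow> 'm lattice \<Rightarrow> real) \<Rightarrow> bool" where
  "edge_factor \<Sigma> x y c \<longleftrightarrow> (\<forall>i j. edge \<Sigma> i j \<longrightarrow>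
     x i \<noteq> x j \<and> c j i \<noteq> 0 \<and> c i j = c j i \<and> diff1 y j i = c j i *\<^sub>R diff1 x j i)"

lemma edge_factorD:
  assumes "edge_factor \<Sigma> x y c" "edge \<Sigma> i j"
  shows "x i \<noteq> x j" "c j i \<noteq> 0" "c i j = c j i" "y j - y i = c j i *\<^sub>R (x j - x i)"
  using assms unfolding edge_factor_def diff1_def by auto

lemma edge_parallel_iff_factor: "edge_parallel \<Sigma> x y \<longleftrightarrow> (\<exists>c. edge_factor \<Sigma> x y c)"
proof
  assume par: "edge_parallel \<Sigma> x y"
  define c where "c j i = (SOME r. r \<noteq> 0 \<and> diff1 y j i = r *\<^sub>R diff1 x j i)" for i j
  have c: "c j i \<noteq> 0 \<and> diff1 y j i = c j i *\<^sub>R diff1 x j i" and x: "x i \<noteq> x j" if "edge \<Sigma> i j" for i j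
  proof -
    have ex: "\<exists>r. r \<noteq> 0 \<and> diff1 y j i = r *\<^sub>R diff1 x j i" and "diff1 x j i \<noteq> 0"
      using par edge_sym[OF that] unfolding edge_parallel_def by blast+
    then show "x i \<noteq> x j" unfolding diff1_def by auto
    show "c j i \<noteq> 0 \<and> diff1 y j i = c j i *\<^sub>R diff1 x j i"
      unfolding c_def by (rule someI_ex[OF ex])
  qed
  have "c i j = c j i" if e: "edge \<Sigma> i j" for i j
  proof -
    have "c i j *\<^sub>R (x i - x j) = - (c j i *\<^sub>R (x j - x i))"
      using c[OF e] c[OF edge_sym[OF e]] unfolding diff1_def by (metis minus_diff_eq)
    then have "(c i j - c j i) *\<^sub>R (x i - x j) = 0" by (simp add: algebra_simps)
    then show ?thesis using x[OF e] by simp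
  qed
  then show "\<exists>c. edge_factor \<Sigma> x y c" using c x unfolding edge_factor_def by blast
next
  assume "\<exists>c. edge_factor \<Sigma> x y c"
  then obtain c where c: "edge_factor \<Sigma> x y c" ..
  show "edge_parallel \<Sigma> x y"
    unfolding edge_parallel_def diff1_def
  proof (intro allI impI)
    fix i j assume "edge \<Sigma> i j"
    note f = edge_factorD[OF c edge_sym[OF this]]
    then show "x i - x j \<noteq> 0 \<and> (\<exists>r. r \<noteq> 0 \<and> y i - y j = r *\<^sub>R (x i - x j))"
      by (intro conjI exI[of _ "c i j"]) auto
  qed
qed

context stereo_frame
begin

text \<open>In contrast to \<open>circular\<close>, the vertex relations are recorded with non-vanishing coefficients, which
  come from the regularity of the lift. This form passes from a net to its Koenigs duals, so that a
  dual can take the place of the original.\<close>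

definition circle_net :: "('m::finite) lattice set \<Rightarrow> ('m lattice \<Rightarrow> real ^ 'n) \<Rightarrow> bool" where
  "circle_net \<Sigma> x \<longleftrightarrow> (\<forall>i\<in>\<Sigma>. x i \<in> affine_part) \<and>
     (\<forall>i j k l. quadrilateral \<Sigma> i j k l \<longrightarrow> (\<exists>a b d. circle_coeffs a b d (x i) (x j) (x k) (x l)))"

lemma stereoprojectionD:
  assumes "stereoprojection B \<oo> \<qq> \<Sigma> s x" "i \<in> \<Sigma>"
  shows "x i \<in> affine_part" "s i = span {lift (x i)}"
  using assms unfolding stereoprojection_def inv_stereo_lift by auto

lemma quadrilateral_vertices:
  "quadrilateral \<Sigma> i j k l \<Longrightarrow> i \<in> \<Sigma> \<and> j \<in> \<Sigma> \<and> k \<in> \<Sigma> \<and> l \<in> \<Sigma>"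
  unfolding quadrilateral_def by simp

lemma circular_circle_net:
  assumes st: "stereoprojection B \<oo> \<qq> \<Sigma> s x" and reg: "regular_net B \<Sigma> s"
    and circ: "circular B \<oo> \<qq> \<Sigma> x"
  shows "circle_net \<Sigma> x"
  unfolding circle_net_def
proof (intro conjI allI impI ballI)
  fix i assume "i \<in> \<Sigma>"
  then show "x i \<in> affine_part" using stereoprojectionD[OF st] by blast
next
  fix i j k l assume Q: "quadrilateral \<Sigma> i j k l"
  then have v: "i \<in> \<Sigma>" "j \<in> \<Sigma>" "k \<in> \<Sigma>" "l \<in> \<Sigma>" using quadrilateral_vertices by blast+
  note S = stereoprojectionD[OF st v(1)] stereoprojectionD[OF st v(2)]
    stereoprojectionD[OF st v(3)] stereoprojectionD[OF st v(4)]
  have ds: "distinct [s i, s j, s k, s l]" and "\<not> form_orthogonal B (s i) (s k)"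
    "\<not> form_orthogonal B (s j) (s l)"
    using reg Q unfolding regular_net_def by blast+
  then have diag: "B (lift (x i)) (lift (x k)) \<noteq> 0" "B (lift (x j)) (lift (x l)) \<noteq> 0"
    using S form_orthogonal_lift by simp_all
  have ne: "x i \<noteq> x j" "x i \<noteq> x l" "x k \<noteq> x j" "x k \<noteq> x l"
    using ds S by auto
  have "quad_dim (\<lambda>n. inv_stereo B \<oo> \<qq> (x n)) i j k l = 3" and ncol: "\<not> collinear {x i, x j, x k, x l}"
    using circ Q unfolding circular_def by blast+
  then have "dim {lift (x i), lift (x j), lift (x k), lift (x l)} \<le> 3"
    unfolding quad_dim_def inv_stereo_lift span_of_spans dim_span by simp
  then show "\<exists>a b d. circle_coeffs a b d (x i) (x j) (x k) (x l)"
    using circle_coeffs_exist[OF S(1,3,5,7) ne diag _ ncol] by blast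
qed

lemma independent_pair_lift:
  "x \<in> affine_part \<Longrightarrow> y \<in> affine_part \<Longrightarrow> x \<noteq> y \<Longrightarrow> independent_pair (lift x) (lift y)"
  unfolding independent_pair_def using lift_pair_independent by blast

lemma act_wedge_lift_q:
  "x \<in> affine_part \<Longrightarrow> y \<in> affine_part \<Longrightarrow> act B (wedge (lift x) (lift y)) \<qq> = lift x - lift y"
  by (simp add: act_wedge[OF bilinear] form_lift_q)

lemma proj_act_wedge_lift_q:
  "x \<in> affine_part \<Longrightarrow> y \<in> affine_part \<Longrightarrow> proj (act B (c *\<^sub>R wedge (lift x) (lift y)) \<qq>) = c *\<^sub>R (x - y)"
  by (simp add: act_wedge_lift_q linear_diff[OF linear_proj] linear_scale[OF linear_proj]
      linear_scale[OF linear_act] proj_lift)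

text \<open>Applying the circulation to \<open>\<qq>\<close> turns \<open>\<sigma>\<^sub>j \<and> \<sigma>\<^sub>i\<close> into \<open>\<sigma>\<^sub>j - \<sigma>\<^sub>i\<close>, so it contains the
  closedness of \<open>c d\<sigma>\<close>. Once this holds, only the excess of \<open>wedge_circulation\<close> is left.\<close>

lemma lifted_quad_closed_iff:
  assumes cc: "circle_coeffs a b d xi xj xk xl"
    and A: "xi \<in> affine_part" "xj \<in> affine_part" "xk \<in> affine_part" "xl \<in> affine_part"
  shows "c4 *\<^sub>R wedge (lift xi) (lift xl) + c3 *\<^sub>R wedge (lift xl) (lift xk) +
      c2 *\<^sub>R wedge (lift xk) (lift xj) + c1 *\<^sub>R wedge (lift xj) (lift xi) = 0 \<longleftrightarrow>
    balanced a b d c1 c2 c3 c4" (is "?\<omega> = 0 \<longleftrightarrow> _")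
proof -
  have k: "lift xk = a *\<^sub>R lift xi + b *\<^sub>R lift xj + d *\<^sub>R lift xl" and abd: "a + b + d = 1"
    and "independent_pair (xj - xi) (xl - xi)"
    using cc unfolding circle_coeffs_def by auto
  then have "independent_pair (proj (lift xj - lift xi)) (proj (lift xl - lift xi))"
    by (simp add: linear_diff[OF linear_proj] proj_lift A)
  then have ind: "independent_pair (lift xj - lift xi) (lift xl - lift xi)"
    using independent_pair_linear_image[OF linear_proj] by blast
  have circulation: "?\<omega> = - (b * c3 + d * c2) *\<^sub>R wedge (lift xj - lift xi) (lift xl - lift xi)"
    if "c1 = a * c2 + (b * c3 + d * c2)" "c4 = a * c3 + (b * c3 + d * c2)"
    using wedge_circulation[OF k abd that] .
  show ?thesis
  proof
    assume zero: "?\<omega> = 0"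
    have "act B ?\<omega> \<qq> = c4 *\<^sub>R (lift xi - lift xl) + c3 *\<^sub>R (lift xl - lift xk) +
        c2 *\<^sub>R (lift xk - lift xj) + c1 *\<^sub>R (lift xj - lift xi)"
      by (simp add: linear_add[OF linear_act] linear_scale[OF linear_act] act_wedge_lift_q A)
    then have c: "c1 = a * c2 + (b * c3 + d * c2)" "c4 = a * c3 + (b * c3 + d * c2)"
      using closed_quad_iff[OF ind k abd] unfolding zero linear_0[OF linear_act] by auto
    then have "b * c3 + d * c2 = 0"
      using circulation[OF c] zero wedge_independent_pair[OF ind] by auto
    then show "balanced a b d c1 c2 c3 c4" using c unfolding balanced_def by simp
  next
    assume "balanced a b d c1 c2 c3 c4"
    then show "?\<omega> = 0" using circulation unfolding balanced_def by simp
  qed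
qed

text \<open>Here \<open>c dx = dy\<close> is closed because \<open>y\<close> exists, so the Koenigs condition only has to remove the
  excess.\<close>

lemma curly_wedge_zero_iff:
  assumes cc: "circle_coeffs a b d (x i) (x j) (x k) (x l)" and Q: "quadrilateral \<Sigma> i j k l"
    and A: "\<forall>i\<in>\<Sigma>. x i \<in> affine_part" and fac: "edge_factor \<Sigma> x y c"
  shows "curly_wedge (diff1 x) (diff1 y) l k j i = 0 \<longleftrightarrow>
    balanced a b d (c j i) (c k j) (c l k) (c i l)"
proof -
  have ind: "independent_pair (x j - x i) (x l - x i)" and abd: "a + b + d = 1"
    using cc unfolding circle_coeffs_def by auto
  have k: "x k = a *\<^sub>R x i + b *\<^sub>R x j + d *\<^sub>R x l"
    using circle_coeffs_affine[OF cc] A quadrilateral_vertices[OF Q] by blast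
  note e = quadrilateral_edges[OF Q]
  note y = edge_factorD(4)[OF fac e(1)] edge_factorD(4)[OF fac e(2)] edge_factorD(4)[OF fac e(3)]
    edge_factorD(4)[OF fac e(4)]
  have "c i l *\<^sub>R (x i - x l) + c l k *\<^sub>R (x l - x k) + c k j *\<^sub>R (x k - x j) + c j i *\<^sub>R (x j - x i) = 0"
    unfolding y[symmetric] by simp
  then have c: "c j i = a * c k j + (b * c l k + d * c k j)" "c i l = a * c l k + (b * c l k + d * c k j)"
    using closed_quad_iff[OF ind k abd] by auto
  have "y j = y i + c j i *\<^sub>R (x j - x i)" "y k = y j + c k j *\<^sub>R (x k - x j)"
    "y l = y i + c i l *\<^sub>R (x l - x i)"
    using y by (simp_all add: algebra_simps)
  from curly_wedge_circulation[OF k abd c this] show ?thesis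
    using c wedge_independent_pair[OF ind] unfolding balanced_def by simp
qed

text \<open>The form vanishes nowhere, so no edge of \<open>x\<close> degenerates and the factor is unique; its symmetry
  comes from the two sign changes, of the form and of the bivector, on reversing the edge.\<close>

lemma isothermic_form_factor:
  assumes st: "stereoprojection B \<oo> \<qq> \<Sigma> s x" and iso: "isothermic_form \<Sigma> s \<eta>"
  obtains c where "\<And>i j. edge \<Sigma> i j \<Longrightarrow> c j i \<noteq> 0 \<and> c i j = c j i \<and> x i \<noteq> x j \<and>
    \<eta> j i = c j i *\<^sub>R wedge (lift (x j)) (lift (x i))"
proof -
  define c where "c j i = (SOME r. \<eta> j i = r *\<^sub>R wedge (lift (x j)) (lift (x i)))" for i j
  have c: "\<eta> j i = c j i *\<^sub>R wedge (lift (x j)) (lift (x i))" if "edge \<Sigma> i j" for i j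
  proof -
    have "i \<in> \<Sigma>" "j \<in> \<Sigma>" using that unfolding edge_def by auto
    then have "s j = span {lift (x j)}" "s i = span {lift (x i)}"
      using stereoprojectionD(2)[OF st] by blast+
    moreover have "\<eta> j i \<in> wedge_space (s j) (s i)"
      using iso that unfolding isothermic_form_def by blast
    ultimately have "\<eta> j i \<in> span {wedge (lift (x j)) (lift (x i))}"
      by (simp only: wedge_space_lines)
    then have "\<exists>r. \<eta> j i = r *\<^sub>R wedge (lift (x j)) (lift (x i))" by (auto simp: span_singleton)
    then show ?thesis unfolding c_def by (rule someI_ex)
  qed
  show ?thesis
  proof (rule that)
    fix i j assume e: "edge \<Sigma> i j"
    have nz: "\<eta> j i \<noteq> 0" and anti: "\<eta> j i = - \<eta> i j"
      using e iso unfolding isothermic_form_def one_form_def by blast+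
    then have w: "wedge (lift (x j)) (lift (x i)) \<noteq> 0" and "c j i \<noteq> 0"
      using c[OF e] by auto
    moreover have "x i \<noteq> x j"
      using w by (auto simp: wedge_self)
    moreover have "(c j i - c i j) *\<^sub>R wedge (lift (x j)) (lift (x i)) = 0"
      using anti unfolding c[OF e] c[OF edge_sym[OF e]] wedge_swap[of "lift (x i)" "lift (x j)"]
      by (simp add: algebra_simps)
    ultimately show "c j i \<noteq> 0 \<and> c i j = c j i \<and> x i \<noteq> x j \<and>
        \<eta> j i = c j i *\<^sub>R wedge (lift (x j)) (lift (x i))"
      using c[OF e] by simp
  qed
qed

lemma form_of_dual_factor:
  assumes st: "stereoprojection B \<oo> \<qq> \<Sigma> s x" and dual: "form_of_dual B \<oo> \<qq> \<Sigma> s \<eta> y"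
  obtains c where "edge_factor \<Sigma> x y c"
    "\<And>i j. edge \<Sigma> i j \<Longrightarrow> \<eta> j i = c j i *\<^sub>R wedge (lift (x j)) (lift (x i))"
proof -
  obtain c where c: "\<And>i j. edge \<Sigma> i j \<Longrightarrow> c j i \<noteq> 0 \<and> c i j = c j i \<and> x i \<noteq> x j \<and>
      \<eta> j i = c j i *\<^sub>R wedge (lift (x j)) (lift (x i))"
    using isothermic_form_factor[OF st] dual unfolding form_of_dual_def by blast
  have "diff1 y j i = c j i *\<^sub>R diff1 x j i" if e: "edge \<Sigma> i j" for i j
  proof -
    have "diff1 y j i = proj (act B (\<eta> j i) \<qq>)" using dual e unfolding form_of_dual_def by blast
    moreover have "x i \<in> affine_part" "x j \<in> affine_part"
      using e stereoprojectionD(1)[OF st] unfolding edge_def by auto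
    ultimately show ?thesis using c[OF e] unfolding diff1_def by (simp add: proj_act_wedge_lift_q)
  qed
  then have "edge_factor \<Sigma> x y c" using c unfolding edge_factor_def by blast
  then show ?thesis using that c by blast
qed

text \<open>The image of \<open>\<eta>\<close> under the linear map \<open>\<omega> \<mapsto> \<pi>(\<omega> \<qq>)\<close> is closed and has a primitive. Projecting
  this primitive places it in the affine model without changing its edges.\<close>

lemma dual_of_isothermic_form:
  assumes dom: "simply_connected_domain \<Sigma>" and st: "stereoprojection B \<oo> \<qq> \<Sigma> s x"
    and net: "circle_net \<Sigma> x" and iso: "isothermic_form \<Sigma> s \<eta>"
  obtains y where "koenigs_dual B \<oo> \<qq> \<Sigma> x y" "form_of_dual B \<oo> \<qq> \<Sigma> s \<eta> y"
proof -
  define \<phi> where "\<phi> = (\<lambda>\<omega>. proj (act B \<omega> \<qq>))"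
  have lin: "linear \<phi>"
    unfolding \<phi>_def using linear_compose[OF linear_act linear_proj] by (simp add: o_def)
  have "one_form \<Sigma> (\<lambda>j i. \<phi> (\<eta> j i))"
    using iso unfolding isothermic_form_def one_form_def by (metis linear_neg[OF lin])
  moreover have "closed_form \<Sigma> (\<lambda>j i. \<phi> (\<eta> j i))"
    unfolding closed_form_def
    using iso by (simp add: isothermic_form_def closed_form_def linear_0[OF lin] flip: linear_add[OF lin])
  ultimately obtain z where z: "\<And>i j. edge \<Sigma> i j \<Longrightarrow> diff1 z j i = \<phi> (\<eta> j i)"
    using closed_form_has_primitive[OF dom] by blast
  \<comment> \<open>The primitive takes values in the ambient space; only its differences lie in the affine model.\<close>
  define y where "y i = proj (z i)" for i
  have "diff1 y j i = proj (act B (\<eta> j i) \<qq>)" if "edge \<Sigma> i j" for i j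
  proof -
    have "diff1 y j i = proj (diff1 z j i)"
      unfolding y_def diff1_def by (simp add: linear_diff[OF linear_proj])
    then show ?thesis
      unfolding z[OF that] \<phi>_def using proj_affine_part[OF proj_in_affine_part] by simp
  qed
  then have dual: "form_of_dual B \<oo> \<qq> \<Sigma> s \<eta> y"
    using iso unfolding form_of_dual_def by blast
  obtain c where fac: "edge_factor \<Sigma> x y c"
    and \<eta>: "\<And>i j. edge \<Sigma> i j \<Longrightarrow> \<eta> j i = c j i *\<^sub>R wedge (lift (x j)) (lift (x i))"
    using form_of_dual_factor[OF st dual] by blast
  have "curly_wedge (diff1 x) (diff1 y) l k j i = 0" if Q: "quadrilateral \<Sigma> i j k l" for i j k l
  proof -
    obtain a b d where cc: "circle_coeffs a b d (x i) (x j) (x k) (x l)"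
      using net Q unfolding circle_net_def by blast
    note e = quadrilateral_edges[OF Q]
    have A: "\<forall>i\<in>\<Sigma>. x i \<in> affine_part" using net unfolding circle_net_def by blast
    have "\<eta> i l + \<eta> l k + \<eta> k j + \<eta> j i = 0"
      using iso Q unfolding isothermic_form_def closed_form_def by blast
    then have "balanced a b d (c j i) (c k j) (c l k) (c i l)"
      using lifted_quad_closed_iff[OF cc] A quadrilateral_vertices[OF Q]
      by (simp add: \<eta>[OF e(1)] \<eta>[OF e(2)] \<eta>[OF e(3)] \<eta>[OF e(4)])
    then show ?thesis using curly_wedge_zero_iff[OF cc Q A fac] by simp
  qed
  moreover have "edge_parallel \<Sigma> x y" using fac edge_parallel_iff_factor by blast
  ultimately have "koenigs_dual B \<oo> \<qq> \<Sigma> x y"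
    unfolding koenigs_dual_def y_def using proj_in_affine_part by auto
  then show ?thesis using that dual by blast
qed

text \<open>The converse construction equips the bivectors \<open>\<sigma>\<^sub>j \<and> \<sigma>\<^sub>i\<close> with the factors of the dual.\<close>

lemma isothermic_form_of_dual:
  assumes st: "stereoprojection B \<oo> \<qq> \<Sigma> s x"
    and net: "circle_net \<Sigma> x" and K: "koenigs_dual B \<oo> \<qq> \<Sigma> x y"
  shows "\<exists>\<eta>. form_of_dual B \<oo> \<qq> \<Sigma> s \<eta> y"
proof -
  have A: "\<forall>i\<in>\<Sigma>. x i \<in> affine_part" using net unfolding circle_net_def by blast
  obtain c where fac: "edge_factor \<Sigma> x y c"
    using K unfolding koenigs_dual_def edge_parallel_iff_factor by blast
  define \<eta> where "\<eta> j i = c j i *\<^sub>R wedge (lift (x j)) (lift (x i))" for i j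
  have V: "i \<in> \<Sigma>" "j \<in> \<Sigma>" if "edge \<Sigma> i j" for i j using that unfolding edge_def by auto
  have "one_form \<Sigma> \<eta>"
    unfolding one_form_def \<eta>_def
  proof (intro allI impI)
    fix i j assume "edge \<Sigma> i j"
    note edge_factorD(3)[OF fac this]
    then show "c j i *\<^sub>R wedge (lift (x j)) (lift (x i)) = - (c i j *\<^sub>R wedge (lift (x i)) (lift (x j)))"
      using wedge_swap[of "lift (x i)" "lift (x j)"] by simp
  qed
  moreover have "closed_form \<Sigma> \<eta>"
    unfolding closed_form_def
  proof (intro allI impI)
    fix i j k l assume Q: "quadrilateral \<Sigma> i j k l"
    obtain a b d where cc: "circle_coeffs a b d (x i) (x j) (x k) (x l)"
      using net Q unfolding circle_net_def by blast
    have "curly_wedge (diff1 x) (diff1 y) l k j i = 0"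
      using K Q unfolding koenigs_dual_def by blast
    then have "balanced a b d (c j i) (c k j) (c l k) (c i l)"
      using curly_wedge_zero_iff[OF cc Q A fac] by simp
    then show "\<eta> i l + \<eta> l k + \<eta> k j + \<eta> j i = 0"
      unfolding \<eta>_def using lifted_quad_closed_iff[OF cc] A quadrilateral_vertices[OF Q] by simp
  qed
  moreover have "\<eta> j i \<noteq> 0 \<and> \<eta> j i \<in> wedge_space (s j) (s i)" if e: "edge \<Sigma> i j" for i j
  proof
    have "wedge (lift (x j)) (lift (x i)) \<noteq> 0"
      using wedge_independent_pair[OF independent_pair_lift[of "x j" "x i"]] A V[OF e]
        edge_factorD(1)[OF fac e] by auto
    then show "\<eta> j i \<noteq> 0" unfolding \<eta>_def using edge_factorD(2)[OF fac e] by simp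
    have "s i = span {lift (x i)}" "s j = span {lift (x j)}" using stereoprojectionD(2)[OF st] V[OF e] by auto
    then show "\<eta> j i \<in> wedge_space (s j) (s i)"
      unfolding \<eta>_def by (simp add: wedge_space_lines span_base span_scale)
  qed
  ultimately have "isothermic_form \<Sigma> s \<eta>" unfolding isothermic_form_def by blast
  moreover have "diff1 y j i = proj (act B (\<eta> j i) \<qq>)" if e: "edge \<Sigma> i j" for i j
    unfolding \<eta>_def using A V[OF e] edge_factorD(4)[OF fac e]
    by (simp add: diff1_def proj_act_wedge_lift_q)
  ultimately show ?thesis unfolding form_of_dual_def by blast
qed

lemma koenigs_dual_sym:
  assumes A: "\<forall>i\<in>\<Sigma>. x i \<in> affine_part" and K: "koenigs_dual B \<oo> \<qq> \<Sigma> x y"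
  shows "koenigs_dual B \<oo> \<qq> \<Sigma> y x"
proof -
  have "edge_parallel \<Sigma> y x"
    unfolding edge_parallel_def
  proof (intro allI impI)
    fix i j assume "edge \<Sigma> i j"
    then obtain r where "diff1 x i j \<noteq> 0" "r \<noteq> 0" "diff1 y i j = r *\<^sub>R diff1 x i j"
      using K unfolding koenigs_dual_def edge_parallel_def by blast
    then have "diff1 y i j \<noteq> 0 \<and> inverse r \<noteq> 0 \<and> diff1 x i j = inverse r *\<^sub>R diff1 y i j" by simp
    then show "diff1 y i j \<noteq> 0 \<and> (\<exists>r. r \<noteq> 0 \<and> diff1 x i j = r *\<^sub>R diff1 y i j)" by blast
  qed
  moreover have "curly_wedge (diff1 y) (diff1 x) l k j i = curly_wedge (diff1 x) (diff1 y) l k j i" for i j k l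
    unfolding curly_wedge_def
    unfolding wedge_swap[of "diff1 x l i + diff1 x k j" "diff1 y j i + diff1 y k l"]
      wedge_swap[of "diff1 x j i + diff1 x k l" "diff1 y l i + diff1 y k j"] by simp
  ultimately show ?thesis using A K unfolding koenigs_dual_def by auto
qed

text \<open>Diagonals of the dual quadrilateral are parallel to the opposite diagonals of the original, so
  non-isotropic diagonals remain non-isotropic.\<close>

lemma koenigs_dual_quad:
  assumes net: "circle_net \<Sigma> x" and K: "koenigs_dual B \<oo> \<qq> \<Sigma> x y" and Q: "quadrilateral \<Sigma> i j k l"
  obtains a b d r r' where "circle_coeffs a b d (y i) (y j) (y k) (y l)"
    "r \<noteq> 0" "y k - y i = r *\<^sub>R (x l - x j)" "r' \<noteq> 0" "y l - y j = r' *\<^sub>R (x k - x i)"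
proof -
  have A: "\<forall>i\<in>\<Sigma>. x i \<in> affine_part" using net unfolding circle_net_def by blast
  then have V: "x i \<in> affine_part" "x j \<in> affine_part" "x k \<in> affine_part" "x l \<in> affine_part"
    using quadrilateral_vertices[OF Q] by auto
  obtain c where fac: "edge_factor \<Sigma> x y c"
    using K unfolding koenigs_dual_def edge_parallel_iff_factor by blast
  obtain a b d where cc: "circle_coeffs a b d (x i) (x j) (x k) (x l)"
    using net Q unfolding circle_net_def by blast
  have "curly_wedge (diff1 x) (diff1 y) l k j i = 0"
    using K Q unfolding koenigs_dual_def by blast
  then have bal: "balanced a b d (c j i) (c k j) (c l k) (c i l)"
    using curly_wedge_zero_iff[OF cc Q A fac] by simp
  note e = quadrilateral_edges[OF Q]
  have "y l - y i = c i l *\<^sub>R (x l - x i)"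
    using edge_factorD(4)[OF fac e(4)] by (simp add: algebra_simps)
  note D = dual_circle_coeffs[OF cc V bal edge_factorD(2)[OF fac e(2)] edge_factorD(4)[OF fac e(1)]
      edge_factorD(4)[OF fac e(2)] this]
  have "d * c k j \<noteq> 0" "- a * c k j / b \<noteq> 0"
    using cc edge_factorD(2)[OF fac e(2)] unfolding circle_coeffs_def by auto
  then show ?thesis using that[OF D(1) _ D(2) _ D(3)] by blast
qed

lemma koenigs_dual_circle_net:
  assumes "circle_net \<Sigma> x" "koenigs_dual B \<oo> \<qq> \<Sigma> x y"
  shows "circle_net \<Sigma> y"
  unfolding circle_net_def
proof (intro conjI allI impI)
  show "\<forall>i\<in>\<Sigma>. y i \<in> affine_part" using assms(2) unfolding koenigs_dual_def by blast
  fix i j k l assume "quadrilateral \<Sigma> i j k l"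
  then show "\<exists>a b d. circle_coeffs a b d (y i) (y j) (y k) (y l)"
    using koenigs_dual_quad[OF assms] by metis
qed

lemma koenigs_dual_regular:
  assumes st: "stereoprojection B \<oo> \<qq> \<Sigma> s x" and reg: "regular_net B \<Sigma> s"
    and net: "circle_net \<Sigma> x" and K: "koenigs_dual B \<oo> \<qq> \<Sigma> x y"
  shows "regular_net B \<Sigma> (\<lambda>i. span {lift (y i)})"
  unfolding regular_net_def
proof (intro allI impI)
  fix i j k l assume Q: "quadrilateral \<Sigma> i j k l"
  then have v: "i \<in> \<Sigma>" "j \<in> \<Sigma>" "k \<in> \<Sigma>" "l \<in> \<Sigma>" using quadrilateral_vertices by blast+
  note S = stereoprojectionD[OF st v(1)] stereoprojectionD[OF st v(2)]
    stereoprojectionD[OF st v(3)] stereoprojectionD[OF st v(4)]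
  have Y: "y i \<in> affine_part" "y j \<in> affine_part" "y k \<in> affine_part" "y l \<in> affine_part"
    using K v unfolding koenigs_dual_def by auto
  have "\<not> form_orthogonal B (s i) (s k)" "\<not> form_orthogonal B (s j) (s l)"
    using reg Q unfolding regular_net_def by blast+
  then have xd: "B (x k - x i) (x k - x i) \<noteq> 0" "B (x l - x j) (x l - x j) \<noteq> 0"
    unfolding S(2,4,6,8) form_orthogonal_lift sym[of "lift (x i)" "lift (x k)"]
    sym[of "lift (x j)" "lift (x l)"]
    using S(1,3,5,7) by (simp_all add: form_lift)
  obtain a b d r r' where cc: "circle_coeffs a b d (y i) (y j) (y k) (y l)"
    and r: "r \<noteq> 0" "y k - y i = r *\<^sub>R (x l - x j)" and r': "r' \<noteq> 0" "y l - y j = r' *\<^sub>R (x k - x i)"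
    using koenigs_dual_quad[OF net K Q] by blast
  have yd: "B (y k - y i) (y k - y i) \<noteq> 0" "B (y l - y j) (y l - y j) \<noteq> 0"
    unfolding r(2) r'(2) using xd r(1) r'(1) by (simp_all add: bilinear_lmul[OF bilinear] bilinear_rmul[OF bilinear])
  have "y k \<noteq> y i" "y l \<noteq> y j" using yd by (auto simp: bilinear_lzero[OF bilinear])
  moreover obtain c where "edge_factor \<Sigma> y x c"
    using koenigs_dual_sym[OF _ K] net unfolding koenigs_dual_def edge_parallel_iff_factor circle_net_def by blast
  then have "y i \<noteq> y j" "y j \<noteq> y k" "y k \<noteq> y l" "y l \<noteq> y i"
    using edge_factorD(1) quadrilateral_edges[OF Q] by blast+
  ultimately have "distinct [span {lift (y i)}, span {lift (y j)}, span {lift (y k)}, span {lift (y l)}]"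
    using span_lift_inj Y by auto
  moreover have "quad_dim (\<lambda>i. span {lift (y i)}) i j k l \<ge> 3"
    unfolding quad_dim_def span_of_spans dim_span using circle_coeffs_dim[OF cc Y(1,2,4)] .
  moreover have "\<not> form_orthogonal B (span {lift (y i)}) (span {lift (y k)})"
    "\<not> form_orthogonal B (span {lift (y j)}) (span {lift (y l)})"
    unfolding form_orthogonal_lift using yd Y sym[of "lift (y i)" "lift (y k)"] sym[of "lift (y j)" "lift (y l)"]
    by (simp_all add: form_lift)
  ultimately show "distinct [span {lift (y i)}, span {lift (y j)}, span {lift (y k)}, span {lift (y l)}] \<and>
      3 \<le> quad_dim (\<lambda>i. span {lift (y i)}) i j k l \<and>
      \<not> form_orthogonal B (span {lift (y i)}) (span {lift (y k)}) \<and>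
      \<not> form_orthogonal B (span {lift (y j)}) (span {lift (y l)})" by blast
qed

text \<open>Duality is symmetric and the dual is again a net of circular quadrilaterals, so
  \<open>isothermic_form_of_dual\<close> applies with \<open>x\<close> as a dual of \<open>y\<close>.\<close>

lemma dual_isothermic:
  assumes st: "stereoprojection B \<oo> \<qq> \<Sigma> s x" and reg: "regular_net B \<Sigma> s"
    and net: "circle_net \<Sigma> x" and K: "koenigs_dual B \<oo> \<qq> \<Sigma> x y"
  shows "\<exists>s'. s' \<in> \<Sigma> \<rightarrow> quadric B - projectivize (light_cone B \<inter> perp B {\<qq>}) \<and>
    regular_net B \<Sigma> s' \<and> stereoprojection B \<oo> \<qq> \<Sigma> s' y \<and> isothermic \<Sigma> s'"
proof (intro exI conjI)
  let ?s = "\<lambda>i. span {lift (y i)}"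
  have Y: "y i \<in> affine_part" if "i \<in> \<Sigma>" for i
    using K that unfolding koenigs_dual_def by auto
  show "?s \<in> \<Sigma> \<rightarrow> quadric B - projectivize (light_cone B \<inter> perp B {\<qq>})"
    using lift_in_quadric Y by blast
  show "regular_net B \<Sigma> ?s" using koenigs_dual_regular[OF st reg net K] .
  show st': "stereoprojection B \<oo> \<qq> \<Sigma> ?s y"
    unfolding stereoprojection_def inv_stereo_lift using Y by blast
  have "koenigs_dual B \<oo> \<qq> \<Sigma> y x"
    using koenigs_dual_sym K net unfolding circle_net_def by blast
  then show "isothermic \<Sigma> ?s"
    using isothermic_form_of_dual[OF st' koenigs_dual_circle_net[OF net K]]
    unfolding isothermic_def form_of_dual_def by blast
qed

section \<open>Uniqueness of the Christoffel dual\<close>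

text \<open>Both sets of factors lie on the line of balanced factors. The conclusion is stated for the edges as
  two-element sets, so that it covers both orientations and both end-points of each edge.\<close>

lemma dual_unique_on_quad:
  assumes net: "circle_net \<Sigma> x" and Q: "quadrilateral \<Sigma> i j k l"
    and K: "koenigs_dual B \<oo> \<qq> \<Sigma> x y" "koenigs_dual B \<oo> \<qq> \<Sigma> x y'"
    and fac: "edge_factor \<Sigma> x y e" "edge_factor \<Sigma> x y' e'"
  obtains r t where "\<And>u v. {u, v} \<in> {{i, j}, {j, k}, {k, l}, {l, i}} \<Longrightarrow>
    edge \<Sigma> u v \<and> e' v u = r * e v u \<and> y' u = r *\<^sub>R y u + t"
proof -
  have A: "\<forall>i\<in>\<Sigma>. x i \<in> affine_part" using net unfolding circle_net_def by blast
  obtain a b d where cc: "circle_coeffs a b d (x i) (x j) (x k) (x l)"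
    using net Q unfolding circle_net_def by blast
  have "curly_wedge (diff1 x) (diff1 y) l k j i = 0" "curly_wedge (diff1 x) (diff1 y') l k j i = 0"
    using K Q unfolding koenigs_dual_def by blast+
  then have bal: "balanced a b d (e j i) (e k j) (e l k) (e i l)"
    "balanced a b d (e' j i) (e' k j) (e' l k) (e' i l)"
    using curly_wedge_zero_iff[OF cc Q A] fac by blast+
  note E = quadrilateral_edges[OF Q]
  have "b \<noteq> 0" using cc unfolding circle_coeffs_def by blast
  then obtain r where r: "e' j i = r * e j i" "e' k j = r * e k j" "e' l k = r * e l k" "e' i l = r * e i l"
    using balanced_unique[OF bal] edge_factorD(2)[OF fac(1) E(2)] edge_factorD(2)[OF fac(2) E(2)] by blast
  have step: "y' v - r *\<^sub>R y v = y' u - r *\<^sub>R y u" if "edge \<Sigma> u v" "e' v u = r * e v u" for u v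
  proof -
    have "y' v - y' u = r *\<^sub>R (y v - y u)"
      using edge_factorD(4)[OF fac(1) that(1)] edge_factorD(4)[OF fac(2) that(1)] that(2) by simp
    then show ?thesis by (simp add: algebra_simps)
  qed
  define t where "t = y' i - r *\<^sub>R y i"
  have t: "y' i = r *\<^sub>R y i + t" "y' j = r *\<^sub>R y j + t" "y' k = r *\<^sub>R y k + t" "y' l = r *\<^sub>R y l + t"
    using step[OF E(1) r(1)] step[OF E(2) r(2)] step[OF E(3) r(3)] unfolding t_def
    by (metis add_diff_cancel_left' add_diff_eq diff_add_cancel add.commute)+
  have r': "e' i j = r * e i j" "e' j k = r * e j k" "e' k l = r * e k l" "e' l i = r * e l i"
    using r edge_factorD(3)[OF fac(1)] edge_factorD(3)[OF fac(2)] E by metis+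
  show ?thesis
    by (rule that[of r t]) (use r r' t E edge_sym in \<open>auto simp: doubleton_eq_iff\<close>)
qed

text \<open>The constants are read off at the edge \<open>ij\<close> and carried along a chain of linked edges: a
  quadrilateral has its own constants by \<open>dual_unique_on_quad\<close>, and one common edge with non-zero
  factor identifies them.\<close>

lemma dual_unique_linked:
  assumes net: "circle_net \<Sigma> x" and st: "stereoprojection B \<oo> \<qq> \<Sigma> s x"
    and K: "koenigs_dual B \<oo> \<qq> \<Sigma> x y" "koenigs_dual B \<oo> \<qq> \<Sigma> x y'"
    and dual: "form_of_dual B \<oo> \<qq> \<Sigma> s \<eta> y" "form_of_dual B \<oo> \<qq> \<Sigma> s \<eta>' y'"
    and ij: "edge \<Sigma> i j"
  obtains c t where "c \<noteq> 0" "t \<in> affine_part"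
    "\<And>k l. edge \<Sigma> k l \<Longrightarrow> linked \<Sigma> {i, j} {k, l} \<Longrightarrow> y' k = c *\<^sub>R y k + t \<and> \<eta>' l k = c *\<^sub>R \<eta> l k"
proof -
  obtain e where e: "edge_factor \<Sigma> x y e"
    and \<eta>: "\<And>i j. edge \<Sigma> i j \<Longrightarrow> \<eta> j i = e j i *\<^sub>R wedge (lift (x j)) (lift (x i))"
    using form_of_dual_factor[OF st dual(1)] by blast
  obtain e' where e': "edge_factor \<Sigma> x y' e'"
    and \<eta>': "\<And>i j. edge \<Sigma> i j \<Longrightarrow> \<eta>' j i = e' j i *\<^sub>R wedge (lift (x j)) (lift (x i))"
    using form_of_dual_factor[OF st dual(2)] by blast
  define c where "c = e' j i / e j i"
  define t where "t = y' i - c *\<^sub>R y i"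
  have c: "c \<noteq> 0" "e' j i = c * e j i"
    unfolding c_def using edge_factorD(2)[OF e ij] edge_factorD(2)[OF e' ij] by simp_all
  \<comment> \<open>Quantifying over all labellings makes the property independent of the orientation.\<close>
  define good where "good f \<longleftrightarrow> (\<forall>u v. f = {u, v} \<longrightarrow>
    edge \<Sigma> u v \<and> e' v u = c * e v u \<and> y' u = c *\<^sub>R y u + t)" for f
  have "good f" if "linked \<Sigma> {i, j} f" for f
    using that unfolding linked_def
  proof (induction rule: rtranclp_induct)
    case base
    have "y' j - y' i = c *\<^sub>R (y j - y i)"
      using edge_factorD(4)[OF e ij] edge_factorD(4)[OF e' ij] c(2) by simp
    then have "y' j = c *\<^sub>R y j + t" "y' i = c *\<^sub>R y i + t"
      unfolding t_def by (simp_all add: algebra_simps)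
    moreover have "e' i j = c * e i j"
      using c(2) edge_factorD(3)[OF e ij] edge_factorD(3)[OF e' ij] by simp
    ultimately show ?case
      unfolding good_def using ij edge_sym[OF ij] c(2) by (auto simp: doubleton_eq_iff)
  next
    case (step f g)
    obtain k l m n where Q: "quadrilateral \<Sigma> k l m n"
      and sub: "{f, g} \<subseteq> {{k, l}, {l, m}, {m, n}, {n, k}}"
      using step(2) unfolding share_quadrilateral_def by (elim exE conjE)
    then have fg: "f \<in> {{k, l}, {l, m}, {m, n}, {n, k}}" "g \<in> {{k, l}, {l, m}, {m, n}, {n, k}}"
      by (simp_all only: insert_subset)
    obtain r w where rw: "\<And>u v. {u, v} \<in> {{k, l}, {l, m}, {m, n}, {n, k}} \<Longrightarrow>
        edge \<Sigma> u v \<and> e' v u = r * e v u \<and> y' u = r *\<^sub>R y u + w"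
      using dual_unique_on_quad[OF net Q K e e'] by blast
    obtain u v where uv: "f = {u, v}" using fg(1) by blast
    have "edge \<Sigma> u v" "e' v u = c * e v u" "y' u = c *\<^sub>R y u + t"
      using step(3) uv unfolding good_def by blast+
    moreover have "e' v u = r * e v u" "y' u = r *\<^sub>R y u + w"
      using rw[OF fg(1)[unfolded uv]] by blast+
    ultimately have "r = c" "w = t"
      using edge_factorD(2)[OF e, of u v] by auto
    then show ?case unfolding good_def using rw fg(2) by metis
  qed
  then have "y' k = c *\<^sub>R y k + t \<and> \<eta>' l k = c *\<^sub>R \<eta> l k" if "edge \<Sigma> k l" "linked \<Sigma> {i, j} {k, l}" for k l
    using that \<eta>[OF that(1)] \<eta>'[OF that(1)] unfolding good_def by simp
  moreover have "t \<in> affine_part"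
    unfolding t_def using K ij unfolding koenigs_dual_def edge_def
    by (intro subspace_diff subspace_scale subspace_affine_part) auto
  ultimately show ?thesis using that c(1) by blast
qed

lemma connected_has_edge:
  assumes "simply_connected_domain \<Sigma>" "i \<in> \<Sigma>" "j \<in> \<Sigma>" "i \<noteq> j"
  obtains k where "edge \<Sigma> i k"
proof -
  obtain ps where ps: "edge_path \<Sigma> ps" "hd ps = i" "last ps = j"
    using assms unfolding simply_connected_domain_def by blast
  then obtain k qs where "ps = i # k # qs"
    using assms(4) unfolding edge_path_def by (metis last.simps list.exhaust_sel)
  then have "edge \<Sigma> i k" using ps(1) unfolding edge_path_def by simp
  then show ?thesis by (rule that)
qed

text \<open>Every vertex lies on an edge as soon as there is one. Without edges a connected domain has at most one
  point, and then a translation suffices.\<close>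

lemma dual_unique:
  assumes dom: "simply_connected_domain \<Sigma>" and conn: "quad_connected \<Sigma>"
    and net: "circle_net \<Sigma> x" and st: "stereoprojection B \<oo> \<qq> \<Sigma> s x"
    and K: "koenigs_dual B \<oo> \<qq> \<Sigma> x y" "koenigs_dual B \<oo> \<qq> \<Sigma> x y'"
    and dual: "form_of_dual B \<oo> \<qq> \<Sigma> s \<eta> y" "form_of_dual B \<oo> \<qq> \<Sigma> s \<eta>' y'"
  shows "\<exists>c t. c \<noteq> 0 \<and> t \<in> affine_part \<and> (\<forall>i\<in>\<Sigma>. y' i = c *\<^sub>R y i + t) \<and>
    (\<forall>i j. edge \<Sigma> i j \<longrightarrow> \<eta>' j i = c *\<^sub>R \<eta> j i)"
proof (cases "\<exists>i j. edge \<Sigma> i j")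
  case True
  then obtain i j where ij: "edge \<Sigma> i j" by blast
  obtain c t where ct: "c \<noteq> 0" "t \<in> affine_part"
    and link: "\<And>k l. edge \<Sigma> k l \<Longrightarrow> linked \<Sigma> {i, j} {k, l} \<Longrightarrow> y' k = c *\<^sub>R y k + t \<and> \<eta>' l k = c *\<^sub>R \<eta> l k"
    using dual_unique_linked[OF net st K dual ij] by blast
  have all: "y' k = c *\<^sub>R y k + t \<and> \<eta>' l k = c *\<^sub>R \<eta> l k" if "edge \<Sigma> k l" for k l
    using link[OF that] conn ij that unfolding quad_connected_def by blast
  have "y' k = c *\<^sub>R y k + t" if k: "k \<in> \<Sigma>" for k
  proof (cases "k = i")
    case True
    then show ?thesis using all ij by blast
  next
    case False
    moreover have "i \<in> \<Sigma>" using ij unfolding edge_def by blast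
    ultimately obtain l where "edge \<Sigma> k l" using connected_has_edge[OF dom k] by blast
    then show ?thesis using all by blast
  qed
  then show ?thesis using ct all by blast
next
  case False
  then have single: "i = j" if "i \<in> \<Sigma>" "j \<in> \<Sigma>" for i j
    using connected_has_edge[OF dom that] by blast
  show ?thesis
  proof (cases "\<Sigma> = {}")
    case True
    then show ?thesis
      using False subspace_0[OF subspace_affine_part] by (intro exI[of _ 1] exI[of _ 0]) auto
  next
    case nonempty: False
    then obtain i where i: "i \<in> \<Sigma>" by blast
    have "y' i - y i \<in> affine_part"
      using K i unfolding koenigs_dual_def by (intro subspace_diff subspace_affine_part) auto
    moreover have "\<forall>k\<in>\<Sigma>. y' k = 1 *\<^sub>R y k + (y' i - y i)" using single[OF i] by auto
    ultimately show ?thesis using False by (intro exI[of _ 1] exI[of _ "y' i - y i"]) auto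
  qed
qed

end

section \<open>Isothermic nets are the lifts of circular nets with a Christoffel dual\<close>

theorem theorem4p11:
  fixes B :: "real ^ 'n \<Rightarrow> real ^ 'n \<Rightarrow> real"
    and p q :: nat
    and \<oo> \<qq> :: "real ^ 'n"
    and \<Sigma> :: "('m::finite) lattice set"
    and s :: "'m lattice \<Rightarrow> (real ^ 'n) set"
    and x :: "'m lattice \<Rightarrow> real ^ 'n"
  assumes form: "symmetric_form B (p + 1) (q + 1)"
    and null: "\<oo> \<in> light_cone B" "\<qq> \<in> light_cone B" "B \<oo> \<qq> = -1"
    and domain: "simply_connected_domain \<Sigma>"
    and net: "s \<in> \<Sigma> \<rightarrow> quadric B - projectivize (light_cone B \<inter> perp B {\<qq>})"
    and regular: "regular_net B \<Sigma> s"
    and planar: "Q_net \<Sigma> s"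
    and stereo: "stereoprojection B \<oo> \<qq> \<Sigma> s x"
    and circ: "circular B \<oo> \<qq> \<Sigma> x"
  shows
    "(isothermic \<Sigma> s \<longleftrightarrow> (\<exists>y. koenigs_dual B \<oo> \<qq> \<Sigma> x y)) \<and>
     (\<forall>\<eta>. isothermic_form \<Sigma> s \<eta> \<longrightarrow>
        (\<exists>y. koenigs_dual B \<oo> \<qq> \<Sigma> x y \<and> form_of_dual B \<oo> \<qq> \<Sigma> s \<eta> y)) \<and>
     (\<forall>y. koenigs_dual B \<oo> \<qq> \<Sigma> x y \<longrightarrow> (\<exists>\<eta>. form_of_dual B \<oo> \<qq> \<Sigma> s \<eta> y)) \<and>
     (\<forall>y. koenigs_dual B \<oo> \<qq> \<Sigma> x y \<longrightarrow>
        (\<exists>s'. s' \<in> \<Sigma> \<rightarrow> quadric B - projectivize (light_cone B \<inter> perp B {\<qq>}) \<and>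
              regular_net B \<Sigma> s' \<and> stereoprojection B \<oo> \<qq> \<Sigma> s' y \<and> isothermic \<Sigma> s')) \<and>
     (\<forall>y y' \<eta> \<eta>'.
        christoffel_dual B \<oo> \<qq> \<Sigma> x y \<and> form_of_dual B \<oo> \<qq> \<Sigma> s \<eta> y \<and>
        christoffel_dual B \<oo> \<qq> \<Sigma> x y' \<and> form_of_dual B \<oo> \<qq> \<Sigma> s \<eta>' y' \<longrightarrow>
        (quad_connected \<Sigma> \<longrightarrow>
           (\<exists>c t. c \<noteq> 0 \<and> t \<in> affine_model B \<oo> \<qq> \<and> (\<forall>i\<in>\<Sigma>. y' i = c *\<^sub>R y i + t) \<and>
                  (\<forall>i j. edge \<Sigma> i j \<longrightarrow> \<eta>' j i = c *\<^sub>R \<eta> j i))) \<and>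
        (\<forall>i j. edge \<Sigma> i j \<longrightarrow>
           (\<exists>c t. c \<noteq> 0 \<and> t \<in> affine_model B \<oo> \<qq> \<and>
                  (\<forall>k l. edge \<Sigma> k l \<and> linked \<Sigma> {i, j} {k, l} \<longrightarrow>
                     y' k = c *\<^sub>R y k + t \<and> \<eta>' l k = c *\<^sub>R \<eta> l k))))"
proof -
  interpret stereo_frame B \<oo> \<qq>
    using form null unfolding symmetric_form_def light_cone_def by unfold_locales auto
  have cn: "circle_net \<Sigma> x" using circular_circle_net[OF stereo regular circ] .
  have to_dual: "\<exists>y. koenigs_dual B \<oo> \<qq> \<Sigma> x y \<and> form_of_dual B \<oo> \<qq> \<Sigma> s \<eta> y"
    if "isothermic_form \<Sigma> s \<eta>" for \<eta>
    using dual_of_isothermic_form[OF domain stereo cn that] by blast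
  have to_form: "\<exists>\<eta>. form_of_dual B \<oo> \<qq> \<Sigma> s \<eta> y" if "koenigs_dual B \<oo> \<qq> \<Sigma> x y" for y
    using isothermic_form_of_dual[OF stereo cn that] .
  show ?thesis
  proof (intro conjI allI impI, goal_cases)
    case 1
    show ?case using to_dual to_form unfolding isothermic_def form_of_dual_def by blast
  next
    case (2 \<eta>)
    then show ?case by (rule to_dual)
  next
    case (3 y)
    then show ?case by (rule to_form)
  next
    case (4 y)
    then show ?case by (rule dual_isothermic[OF stereo regular cn])
  next
    case (5 y y' \<eta> \<eta>')
    then show ?case
      using dual_unique[OF domain _ cn stereo, of y y' \<eta> \<eta>'] unfolding christoffel_dual_def by blast
  next
    case (6 y y' \<eta> \<eta>' i j)
    then have dual: "koenigs_dual B \<oo> \<qq> \<Sigma> x y" "koenigs_dual B \<oo> \<qq> \<Sigma> x y'"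
      "form_of_dual B \<oo> \<qq> \<Sigma> s \<eta> y" "form_of_dual B \<oo> \<qq> \<Sigma> s \<eta>' y'" and ij: "edge \<Sigma> i j"
      unfolding christoffel_dual_def by blast+
    obtain c t where "c \<noteq> 0" "t \<in> affine_part" "\<And>k l. edge \<Sigma> k l \<Longrightarrow> linked \<Sigma> {i, j} {k, l} \<Longrightarrow>
        y' k = c *\<^sub>R y k + t \<and> \<eta>' l k = c *\<^sub>R \<eta> l k"
      using dual_unique_linked[OF cn stereo dual ij] by blast
    then show ?case by blast
  qed
qed

end
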